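(* Let $1<p<\infty$, let $p^*$ be the conjugate exponent of $p$, let $X$ be a Banach space, and let $A$ be a bounded subset of $X^*$. The following are equivalent: (i) $A$ is a weakly-$p$-$L$-subset of $X^*$. (ii) $T^*(A)$ is relatively compact whenever $Y$ is a Banach space and $T:Y\to X$ is a weakly-$p$-precompact operator. (iii) $T^*(A)$ is relatively compact whenever $Y$ is a Banach space with $Y\in WPC_p$ and $T:Y\to X$ is an operator. (iv) $T^*(A)$ is relatively compact whenever $T:\ell_{p^*}\to X$ is an operator. (v) If $(x_n)$ is a weakly $p$-summable sequence in $X$ and $(x_n^* )$ is a sequence in $A$, then $\lim_n x_n^*(x_n)=0$.
   Context: Operators are continuous linear maps between Banach spaces. A sequence $(x_n)$ in a Banach space $E$ is weakly $p$-summable if $(x^*(x_n))_n\in\ell_p$ for every $x^*\in E^*$. A bounded subset $A$ of $X^*$ is a weakly-$p$-$L$-set (weakly-$p$-$L$-subset of $X^*$) if $\sup_{x^*\in A}|x^*(x_n)|\to 0$ for every weakly $p$-summable sequence $(x_n)$ in $X$. A sequence $(x_n)$ in $E$ is weakly-$p$-Cauchy if $(x_{n_k}-x_{m_k})_k$ is weakly $p$-summable for any increasing sequences $(n_k)$ and $(m_k)$ of positive integers. A subset $S$ of $E$ is weakly-$p$-precompact if every sequence from $S$ has a weakly-$p$-Cauchy subsequence. An operator $T:Y\to X$ is weakly-$p$-precompact if $T(B_Y)$ is weakly-$p$-precompact, where $B_Y$ is the unit ball of $Y$. $Y\in WPC_p$ means that the identity operator on $Y$ is weakly-$p$-precompact.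 *)

theory Defs
  imports "HOL-Analysis.Analysis"
begin

text \<open>
  The equivalence quantifies over all Banach spaces \<open>Y\<close> inside a formula. A type class cannot be
  quantified over in HOL, so normed spaces (over the real field) are represented as records
  with an explicit carrier. All notions below are defined for such records, and a type of class
  \<open>banach\<close> is turned into one by \<open>type_space\<close>.
\<close>

record 'a nspace =
  vset :: "'a set"
  vzero :: 'a
  vadd :: "'a \<Rightarrow> 'a \<Rightarrow> 'a"
  vscale :: "real \<Rightarrow> 'a \<Rightarrow> 'a"
  vnorm :: "'a \<Rightarrow> real"

definition vdiff :: "'a nspace \<Rightarrow> 'a \<Rightarrow> 'a \<Rightarrow> 'a" where
  "vdiff E x y = vadd E x (vscale E (-1) y)"

(* Metric_space requires nonnegativity and symmetry also outside the carrier. *)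
definition vdist :: "'a nspace \<Rightarrow> 'a \<Rightarrow> 'a \<Rightarrow> real" where
  "vdist E x y = (if x \<in> vset E \<and> y \<in> vset E then vnorm E (vdiff E x y) else 0)"

definition vtop :: "'a nspace \<Rightarrow> 'a topology" where
  "vtop E = Metric_space.mtopology (vset E) (vdist E)"

locale normed_space =
  fixes E :: "'a nspace"
  assumes zero_closed: "vzero E \<in> vset E"
    and add_closed: "\<lbrakk>x \<in> vset E; y \<in> vset E\<rbrakk> \<Longrightarrow> vadd E x y \<in> vset E"
    and scale_closed: "x \<in> vset E \<Longrightarrow> vscale E a x \<in> vset E"
    and add_assoc:
      "\<lbrakk>x \<in> vset E; y \<in> vset E; z \<in> vset E\<rbrakk> \<Longrightarrow> vadd E (vadd E x y) z = vadd E x (vadd E y z)"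
    and add_commute: "\<lbrakk>x \<in> vset E; y \<in> vset E\<rbrakk> \<Longrightarrow> vadd E x y = vadd E y x"
    and add_zero: "x \<in> vset E \<Longrightarrow> vadd E x (vzero E) = x"
    and add_inverse: "x \<in> vset E \<Longrightarrow> \<exists>y\<in>vset E. vadd E x y = vzero E"
    and scale_add_right:
      "\<lbrakk>x \<in> vset E; y \<in> vset E\<rbrakk> \<Longrightarrow> vscale E a (vadd E x y) = vadd E (vscale E a x) (vscale E a y)"
    and scale_add_left:
      "x \<in> vset E \<Longrightarrow> vscale E (a + b) x = vadd E (vscale E a x) (vscale E b x)"
    and scale_scale: "x \<in> vset E \<Longrightarrow> vscale E a (vscale E b x) = vscale E (a * b) x"
    and scale_one: "x \<in> vset E \<Longrightarrow> vscale E 1 x = x"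
    and norm_nonneg: "x \<in> vset E \<Longrightarrow> 0 \<le> vnorm E x"
    and norm_eq_zero: "x \<in> vset E \<Longrightarrow> vnorm E x = 0 \<longleftrightarrow> x = vzero E"
    and norm_scale: "x \<in> vset E \<Longrightarrow> vnorm E (vscale E a x) = \<bar>a\<bar> * vnorm E x"
    and norm_triangle:
      "\<lbrakk>x \<in> vset E; y \<in> vset E\<rbrakk> \<Longrightarrow> vnorm E (vadd E x y) \<le> vnorm E x + vnorm E y"

locale banach_space = normed_space +
  assumes complete: "Metric_space.mcomplete (vset E) (vdist E)"

definition type_space :: "'a::real_normed_vector nspace" where
  "type_space = \<lparr>vset = UNIV, vzero = 0, vadd = (+), vscale = scaleR, vnorm = norm\<rparr>"

definition unit_ball :: "'a nspace \<Rightarrow> 'a set" where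
  "unit_ball E = {x \<in> vset E. vnorm E x \<le> 1}"

definition norm_bounded :: "'a nspace \<Rightarrow> 'a set \<Rightarrow> bool" where
  "norm_bounded E S \<longleftrightarrow> S \<subseteq> vset E \<and> (\<exists>M. \<forall>x\<in>S. vnorm E x \<le> M)"

definition relatively_compact :: "'a nspace \<Rightarrow> 'a set \<Rightarrow> bool" where
  "relatively_compact E S \<longleftrightarrow> S \<subseteq> vset E \<and> compactin (vtop E) (vtop E closure_of S)"

text \<open>Operators are continuous linear maps; their values outside the carrier are irrelevant.\<close>

definition operator :: "'a nspace \<Rightarrow> 'b nspace \<Rightarrow> ('a \<Rightarrow> 'b) \<Rightarrow> bool" where
  "operator E F T \<longleftrightarrow>
     continuous_map (vtop E) (vtop F) T \<and>
     (\<forall>x\<in>vset E. \<forall>y\<in>vset E. T (vadd E x y) = vadd F (T x) (T y)) \<and>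
     (\<forall>a. \<forall>x\<in>vset E. T (vscale E a x) = vscale F a (T x))"

text \<open>
  Functionals are restricted to the carrier, so that two elements of the dual that agree on the
  space are equal.
\<close>

definition dual :: "'a nspace \<Rightarrow> ('a \<Rightarrow> real) nspace" where
  "dual E =
     \<lparr>vset = {f \<in> extensional (vset E). operator E type_space f},
      vzero = (\<lambda>x\<in>vset E. 0),
      vadd = (\<lambda>f g. \<lambda>x\<in>vset E. f x + g x),
      vscale = (\<lambda>a f. \<lambda>x\<in>vset E. a * f x),
      vnorm = (\<lambda>f. SUP x\<in>unit_ball E. \<bar>f x\<bar>)\<rparr>"

definition adjoint_op :: "'a nspace \<Rightarrow> ('a \<Rightarrow> 'b) \<Rightarrow> ('b \<Rightarrow> real) \<Rightarrow> ('a \<Rightarrow> real)" where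
  "adjoint_op E T f = (\<lambda>x\<in>vset E. f (T x))"

definition ell :: "real \<Rightarrow> (nat \<Rightarrow> real) nspace" where
  "ell p =
     \<lparr>vset = {a. summable (\<lambda>n. \<bar>a n\<bar> powr p)},
      vzero = (\<lambda>n. 0),
      vadd = (\<lambda>a b n. a n + b n),
      vscale = (\<lambda>c a n. c * a n),
      vnorm = (\<lambda>a. (\<Sum>n. \<bar>a n\<bar> powr p) powr (1 / p))\<rparr>"

definition weakly_p_summable :: "real \<Rightarrow> 'a nspace \<Rightarrow> (nat \<Rightarrow> 'a) \<Rightarrow> bool" where
  "weakly_p_summable p E x \<longleftrightarrow>
     range x \<subseteq> vset E \<and> (\<forall>f\<in>vset (dual E). (\<lambda>n. f (x n)) \<in> vset (ell p))"

(* Inserting 0 only matters for A = {}, where it makes the supremum 0. *)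
definition weakly_p_L_set :: "real \<Rightarrow> 'a nspace \<Rightarrow> ('a \<Rightarrow> real) set \<Rightarrow> bool" where
  "weakly_p_L_set p E A \<longleftrightarrow>
     norm_bounded (dual E) A \<and>
     (\<forall>x. weakly_p_summable p E x \<longrightarrow>
        (\<lambda>n. Sup (insert 0 ((\<lambda>f. \<bar>f (x n)\<bar>) ` A))) \<longlonglongrightarrow> 0)"

definition weakly_p_Cauchy :: "real \<Rightarrow> 'a nspace \<Rightarrow> (nat \<Rightarrow> 'a) \<Rightarrow> bool" where
  "weakly_p_Cauchy p E x \<longleftrightarrow>
     range x \<subseteq> vset E \<and>
     (\<forall>n m :: nat \<Rightarrow> nat. strict_mono n \<longrightarrow> strict_mono m \<longrightarrow>
        weakly_p_summable p E (\<lambda>k. vdiff E (x (n k)) (x (m k))))"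

definition weakly_p_precompact :: "real \<Rightarrow> 'a nspace \<Rightarrow> 'a set \<Rightarrow> bool" where
  "weakly_p_precompact p E S \<longleftrightarrow>
     S \<subseteq> vset E \<and>
     (\<forall>x. range x \<subseteq> S \<longrightarrow>
        (\<exists>r :: nat \<Rightarrow> nat. strict_mono r \<and> weakly_p_Cauchy p E (x \<circ> r)))"

definition weakly_p_precompact_op ::
    "real \<Rightarrow> 'a nspace \<Rightarrow> 'b nspace \<Rightarrow> ('a \<Rightarrow> 'b) \<Rightarrow> bool" where
  "weakly_p_precompact_op p E F T \<longleftrightarrow>
     operator E F T \<and> weakly_p_precompact p F (T ` unit_ball E)"

definition WPC :: "real \<Rightarrow> 'a nspace \<Rightarrow> bool" where
  "WPC p E \<longleftrightarrow> weakly_p_precompact_op p E E (\<lambda>x. x)"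

text \<open>
  The carriers of the quantified Banach spaces are sets of elements of \<open>'u universe\<close>, where
  \<open>'u\<close> is an arbitrary type. Every Banach space with elements of type \<open>'u\<close> has a copy there
  (along \<open>Inl\<close>), and so has every sequence space (along \<open>Inr\<close>), whatever \<open>'u\<close> is. Without the
  second summand, a small type \<open>'u\<close> would make a quantification over Banach spaces vacuous.
\<close>

type_synonym 'u universe = "'u + (nat \<Rightarrow> real)"

definition all_equivalent :: "bool list \<Rightarrow> bool" where
  "all_equivalent Ps \<longleftrightarrow> (\<forall>P\<in>set Ps. \<forall>Q\<in>set Ps. P \<longleftrightarrow> Q)"


subsection \<open>Consistency with the type-class notions\<close>

lemma type_space_simps [simp]:
  "vset type_space = UNIV" "vzero type_space = 0" "vadd type_space = (+)"
  "vscale type_space = scaleR" "vnorm type_space = norm"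
  by (simp_all add: type_space_def)

lemma vdist_type_space [simp]: "vdist type_space = dist"
  by (auto simp: fun_eq_iff vdist_def vdiff_def dist_norm)

lemma vtop_type_space [simp]: "vtop type_space = euclidean"
  by (simp add: vtop_def)

lemma normed_space_type_space: "normed_space (type_space :: 'a::real_normed_vector nspace)"
proof
  show "\<exists>y\<in>vset type_space. vadd type_space x y = vzero type_space" for x :: 'a
    by (rule bexI[of _ "- x"]) auto
qed (auto simp: algebra_simps norm_triangle_ineq)

lemma banach_space_type_space: "banach_space (type_space :: 'a::banach nspace)"
  unfolding banach_space_def banach_space_axioms_def
  by (simp add: normed_space_type_space complete_UNIV)

lemma Metric_space_vdist:
  assumes "normed_space E" shows "Metric_space (vset E) (vdist E)"
proof -
  interpret normed_space E by fact
  have cl: "vdiff E x y \<in> vset E" if "x \<in> vset E" "y \<in> vset E" for x y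
    using that by (simp add: vdiff_def add_closed scale_closed)
  have scale0: "vscale E 0 x = vzero E" if "x \<in> vset E" for x
    using that by (metis abs_zero mult_zero_left norm_eq_zero norm_scale scale_closed)
  have self: "vadd E x (vscale E (-1) x) = vzero E" if "x \<in> vset E" for x
    using that scale_add_left[of x 1 "-1"] by (simp add: scale_one scale0)
  have add_diff: "vadd E (vdiff E x y) (vdiff E y z) = vdiff E x z"
    if "x \<in> vset E" "y \<in> vset E" "z \<in> vset E" for x y z
  proof -
    have "vadd E (vdiff E x y) (vdiff E y z)
        = vadd E x (vadd E (vadd E (vscale E (-1) y) y) (vscale E (-1) z))"
      using that by (simp add: vdiff_def add_assoc add_closed scale_closed)
    also have "\<dots> = vadd E x (vadd E (vzero E) (vscale E (-1) z))"
      using that by (metis add_commute scale_closed self)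
    also have "\<dots> = vdiff E x z"
      using that by (metis add_commute add_zero scale_closed vdiff_def zero_closed)
    finally show ?thesis .
  qed
  have swap: "vscale E (-1) (vdiff E x y) = vdiff E y x"
    if "x \<in> vset E" "y \<in> vset E" for x y
    using that
    by (simp add: vdiff_def scale_add_right scale_closed scale_scale scale_one add_commute)
  show ?thesis
  proof
    show "0 \<le> vdist E x y" for x y
      by (simp add: vdist_def cl norm_nonneg)
    show "vdist E x y = vdist E y x" for x y
      using norm_scale[OF cl, of x y "-1"] by (simp add: vdist_def swap)
    show "vdist E x y = 0 \<longleftrightarrow> x = y" if "x \<in> vset E" "y \<in> vset E" for x y
    proof
      assume "vdist E x y = 0"
      then have "vdiff E x y = vzero E"
        using that by (simp add: vdist_def cl norm_eq_zero)
      moreover have "vadd E (vdiff E x y) y = x"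
        using that by (metis add_assoc add_commute add_zero scale_closed self vdiff_def)
      ultimately show "x = y"
        using that by (metis add_commute add_zero zero_closed)
    qed (use that in \<open>simp add: vdist_def vdiff_def self norm_eq_zero zero_closed\<close>)
    show "vdist E x z \<le> vdist E x y + vdist E y z"
      if "x \<in> vset E" "y \<in> vset E" "z \<in> vset E" for x y z
      using that norm_triangle[OF cl cl, of x y y z] by (simp add: vdist_def add_diff)
  qed
qed

lemma operator_type_space_iff:
  fixes T :: "'a::real_normed_vector \<Rightarrow> 'b::real_normed_vector"
  shows "operator type_space type_space T \<longleftrightarrow> bounded_linear T"
proof
  assume T: "operator type_space type_space T"
  then have lin: "linear T" and cont: "continuous_on UNIV T"
    by (auto simp: operator_def intro!: linearI)
  from cont have "isCont T 0"
    by (simp add: continuous_on_eq_continuous_at)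
  then obtain d where d: "d > 0" "\<And>x. norm x < d \<Longrightarrow> norm (T x) < 1"
    using linear_0[OF lin] unfolding continuous_at_eps_delta
    by (metis dist_norm diff_zero zero_less_one)
  have "norm (T x) \<le> norm x * (2 / d)" for x
  proof (cases "x = 0")
    case True then show ?thesis using linear_0[OF lin] by simp
  next
    case False
    let ?c = "d / (2 * norm x)"
    have "norm (T (?c *\<^sub>R x)) < 1"
      using False d(1) by (intro d(2)) simp
    then have "?c * norm (T x) < 1"
      using d(1) by (simp add: linear_scale[OF lin])
    then show ?thesis using False d(1) by (simp add: field_simps)
  qed
  then show "bounded_linear T"
    using lin by (intro bounded_linear_intro[where K = "2 / d"]) (auto simp: linear_add linear_scale)
next
  assume T: "bounded_linear T"
  then interpret bounded_linear T .
  show "operator type_space type_space T"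
    by (auto simp: operator_def add scaleR linear_continuous_on[OF T])
qed

lemma vset_dual_type_space:
  "vset (dual (type_space :: 'a::real_normed_vector nspace)) = Collect bounded_linear"
  by (auto simp: dual_def operator_type_space_iff)

end

theory Submission
  imports Defs
begin

text \<open>
  A seminorm argument gives (i) \<open>\<Longrightarrow>\<close> (ii): the sequences in \<open>T(B\<^sub>Y)\<close> have weakly-\<open>p\<close>-Cauchy
  subsequences, so \<open>T(B\<^sub>Y)\<close> is totally bounded for the seminorm \<open>z \<mapsto> sup \<bar>f z\<bar>\<close> over
  \<open>f \<in> A\<close>, and a finite net of \<open>T(B\<^sub>Y)\<close> yields a finite net of \<open>A\<close> for uniform
  convergence on \<open>T(B\<^sub>Y)\<close>. Specialising to \<open>\<ell>\<^sub>q\<close>, with \<open>q\<close> the conjugate exponent, requires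
  that \<open>\<ell>\<^sub>q\<close> is in \<open>WPC\<^sub>p\<close>: a bounded sequence converges coordinatewise along a subsequence, and a
  coordinatewise null sequence has a subsequence close to disjoint blocks, which satisfies an upper
  \<open>q\<close>-estimate and is therefore weakly \<open>p\<close>-summable. Conversely, a weakly \<open>p\<close>-summable sequence
  \<open>x\<close> in \<open>X\<close> is the image of the unit vectors under the operator
  \<open>a \<mapsto> \<Sum> a\<^sub>n x\<^sub>n\<close> on \<open>\<ell>\<^sub>q\<close>, which is bounded because weakly bounded sets are bounded
  (norming functionals and the Baire category theorem). A finite net of \<open>A\<close> on the image of the
  ball reduces (v) to finitely many functionals.
\<close>

section \<open>Norming functionals and uniform boundedness\<close>

text \<open>The space \<open>X\<close> is a type of class \<open>banach\<close>, while each
  \<open>Y\<close> is a record. Hahn-Banach and Baire are applied to \<open>X\<close> and its dual,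
  so they are set up for types. For \<open>Y\<close> what counts is completeness of the dual, which
  identifies relative compactness with total boundedness. Every compactness claim then becomes a
  statement about the values of \<open>A\<close> on the image of the unit ball of \<open>Y\<close>
  under \<open>T\<close>, and \<open>Y\<close> enters in no other way. This is what makes the spaces
  in (ii), (iii) and (iv) comparable. The exponent q enters by duality. An upper q-estimate says
  that combining a sequence with coefficients from \<open>ell q\<close> is a bounded operation.
  Testing a functional on such combinations, with coefficients adapted to it, makes its values
  p-summable. Disjoint blocks satisfy the estimate because q-th powers of disjointly supported
  sequences add. The same duality, read backwards, produces the operator generated by a weakly
  p-summable sequence.\<close>

definition sublinear :: "('a::real_vector \<Rightarrow> real) \<Rightarrow> bool" where
  "sublinear g \<longleftrightarrow>
     (\<forall>x y. g (x + y) \<le> g x + g y) \<and> (\<forall>c x. 0 \<le> c \<longrightarrow> g (c *\<^sub>R x) = c * g x)"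

text \<open>One inequality for all positive factors suffices: applied to \<open>inverse c\<close>
  and \<open>c *\<^sub>R x\<close> it gives the reverse one.\<close>

lemma sublinearI:
  assumes "\<And>x y. g (x + y) \<le> g x + g y"
    and "g 0 = 0"
    and le: "\<And>c x. 0 < c \<Longrightarrow> g (c *\<^sub>R x) \<le> c * g x"
  shows "sublinear g"
  unfolding sublinear_def
proof (intro conjI allI impI)
  fix c :: real and x
  assume "0 \<le> c"
  show "g (c *\<^sub>R x) = c * g x"
  proof (cases "c = 0")
    case False
    with \<open>0 \<le> c\<close> have "0 < c" by simp
    then have "g x \<le> inverse c * g (c *\<^sub>R x)"
      using le[of "inverse c" "c *\<^sub>R x"] by simp
    then have "c * g x \<le> g (c *\<^sub>R x)"
      using \<open>0 < c\<close> by (simp add: field_simps)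
    then show ?thesis using le[OF \<open>0 < c\<close>] by (simp add: antisym)
  qed (simp add: assms(2))
qed (rule assms(1))

lemma sublinear_add: "sublinear g \<Longrightarrow> g (x + y) \<le> g x + g y"
  and sublinear_scale: "sublinear g \<Longrightarrow> 0 \<le> c \<Longrightarrow> g (c *\<^sub>R x) = c * g x"
  by (auto simp: sublinear_def)

lemma sublinear_zero: "sublinear g \<Longrightarrow> g 0 = 0"
  using sublinear_scale[of g 0 0] by simp

lemma sublinear_minus_ge: "sublinear g \<Longrightarrow> - g (- x) \<le> g x"
  using sublinear_add[of g x "- x"] sublinear_zero[of g] by simp

lemma sublinear_norm: "sublinear norm"
  by (rule sublinearI) (auto simp: norm_triangle_ineq)

text \<open>Lowers \<open>g\<close> so that the value at \<open>- y\<close> becomes at most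
  \<open>- g y\<close> (take t = 1), while staying sublinear and below \<open>g\<close>. A linear
  functional below \<open>shear g y\<close> must therefore take the value \<open>g y\<close> at
  \<open>y\<close>.\<close>

definition shear :: "('a::real_vector \<Rightarrow> real) \<Rightarrow> 'a \<Rightarrow> 'a \<Rightarrow> real" where
  "shear g y x = (INF t\<in>{0..}. g (x + t *\<^sub>R y) - t * g y)"

context
  fixes g :: "'a::real_vector \<Rightarrow> real" and y :: 'a
  assumes g: "sublinear g"
begin

text \<open>The bound does not depend on t, so the infimum defining \<open>shear\<close> is a
  genuine one.\<close>

lemma shear_lower: "0 \<le> t \<Longrightarrow> - g (- x) \<le> g (x + t *\<^sub>R y) - t * g y"
  using sublinear_add[OF g, of "x + t *\<^sub>R y" "- x"] sublinear_scale[OF g, of t y] by simp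

lemma bdd_below_shear: "bdd_below ((\<lambda>t. g (x + t *\<^sub>R y) - t * g y) ` {0..})"
  using shear_lower by (intro bdd_belowI2[of _ "- g (- x)"]) auto

lemma shear_le: "0 \<le> t \<Longrightarrow> shear g y x \<le> g (x + t *\<^sub>R y) - t * g y"
  unfolding shear_def by (intro cINF_lower bdd_below_shear) auto

lemma shear_le_self: "shear g y x \<le> g x"
  using shear_le[of 0 x] by simp

lemma shear_greatest:
  "(\<And>t. 0 \<le> t \<Longrightarrow> m \<le> g (x + t *\<^sub>R y) - t * g y) \<Longrightarrow> m \<le> shear g y x"
  unfolding shear_def by (intro cINF_greatest) auto

lemma sublinear_shear: "sublinear (shear g y)"
proof (rule sublinearI)
  fix u v
  \<comment> \<open>The parameters add: t for \<open>v\<close> and s for \<open>u\<close> give s + t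
    for the sum. The two infima are then taken one after the other.\<close>
  have *: "shear g y (u + v) \<le> (g (u + s *\<^sub>R y) - s * g y) + (g (v + t *\<^sub>R y) - t * g y)"
    if "0 \<le> s" "0 \<le> t" for s t
    using shear_le[of "s + t" "u + v"] that
      sublinear_add[OF g, of "u + s *\<^sub>R y" "v + t *\<^sub>R y"]
    by (simp add: algebra_simps)
  have "shear g y (u + v) - (g (u + s *\<^sub>R y) - s * g y) \<le> shear g y v" if "0 \<le> s" for s
    using *[OF that] by (intro shear_greatest) (simp add: algebra_simps)
  then have "shear g y (u + v) - shear g y v \<le> shear g y u"
    by (intro shear_greatest) (simp add: algebra_simps)
  then show "shear g y (u + v) \<le> shear g y u + shear g y v" by simp
next
  have "0 \<le> shear g y 0"
    by (intro shear_greatest) (simp add: sublinear_scale[OF g])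
  then show "shear g y 0 = 0"
    using shear_le_self[of 0] by (simp add: sublinear_zero[OF g])
next
  fix c :: real and x
  assume c: "0 < c"
  \<comment> \<open>Homogeneity comes from replacing the parameter t by
    \<open>c * t\<close>.\<close>
  have "inverse c * shear g y (c *\<^sub>R x) \<le> shear g y x"
  proof (rule shear_greatest)
    fix t :: real assume "0 \<le> t"
    then have "shear g y (c *\<^sub>R x) \<le> c * (g (x + t *\<^sub>R y) - t * g y)"
      using shear_le[of "c * t" "c *\<^sub>R x"] sublinear_scale[OF g, of c "x + t *\<^sub>R y"] c
      by (simp add: algebra_simps)
    then show "inverse c * shear g y (c *\<^sub>R x) \<le> g (x + t *\<^sub>R y) - t * g y"
      using c by (simp add: field_simps)
  qed
  then show "shear g y (c *\<^sub>R x) \<le> c * shear g y x"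
    using c by (simp add: field_simps)
qed

end

text \<open>Subadditivity of the infimum is where the chain is needed: for \<open>f\<close> and
  \<open>g\<close> evaluated at two different points, the smaller of the two serves at both.\<close>

lemma sublinear_cINF:
  assumes "C \<noteq> {}" and sub: "\<And>g. g \<in> C \<Longrightarrow> sublinear g"
    and chain: "\<And>f g. f \<in> C \<Longrightarrow> g \<in> C \<Longrightarrow> f \<le> g \<or> g \<le> f"
    and below: "\<And>g. g \<in> C \<Longrightarrow> g \<le> h"
  shows "sublinear (\<lambda>x. INF g\<in>C. g x)" and "\<And>g x. g \<in> C \<Longrightarrow> (INF g\<in>C. g x) \<le> g x"
proof -
  \<comment> \<open>The common upper bound \<open>h\<close>, taken at \<open>- x\<close>, yields a
    common lower bound at \<open>x\<close>.\<close>
  have bdd: "bdd_below ((\<lambda>g. g x) ` C)" for x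
  proof (intro bdd_belowI2)
    fix g assume "g \<in> C"
    then show "- h (- x) \<le> g x"
      using sublinear_minus_ge[OF sub, of g x] le_funD[OF below, of g "- x"] by linarith
  qed
  show low: "(INF g\<in>C. g x) \<le> g x" if "g \<in> C" for g x
    by (intro cINF_lower bdd that)
  show "sublinear (\<lambda>x. INF g\<in>C. g x)"
  proof (rule sublinearI)
    fix x y
    have *: "(INF g\<in>C. g (x + y)) \<le> f x + g y" if "f \<in> C" "g \<in> C" for f g
      using chain[OF that]
    proof
      assume "f \<le> g"
      then show ?thesis
        using low[OF that(1), of "x + y"] sublinear_add[OF sub[OF that(1)], of x y]
        by (force simp: le_fun_def intro: order_trans)
    next
      assume "g \<le> f"
      then show ?thesis
        using low[OF that(2), of "x + y"] sublinear_add[OF sub[OF that(2)], of x y]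
        by (force simp: le_fun_def intro: order_trans)
    qed
    have "(INF g\<in>C. g (x + y)) - f x \<le> (INF g\<in>C. g y)" if "f \<in> C" for f
      using *[OF that] by (intro cINF_greatest assms(1)) (simp add: algebra_simps)
    then have "(INF g\<in>C. g (x + y)) - (INF g\<in>C. g y) \<le> (INF g\<in>C. g x)"
      by (intro cINF_greatest assms(1)) (simp add: algebra_simps)
    then show "(INF g\<in>C. g (x + y)) \<le> (INF g\<in>C. g x) + (INF g\<in>C. g y)" by simp
  next
    have "(INF g\<in>C. g 0) = (INF g\<in>C. 0 :: real)"
      by (intro INF_cong refl) (simp add: sublinear_zero[OF sub])
    then show "(INF g\<in>C. g 0) = 0" using assms(1) by simp
  next
    fix c :: real and x assume c: "0 < c"
    have "inverse c * (INF g\<in>C. g (c *\<^sub>R x)) \<le> (INF g\<in>C. g x)"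
    proof (intro cINF_greatest assms(1))
      fix g assume "g \<in> C"
      then show "inverse c * (INF g\<in>C. g (c *\<^sub>R x)) \<le> g x"
        using low[of g "c *\<^sub>R x"] sublinear_scale[OF sub, of g c x] c by (simp add: field_simps)
    qed
    then show "(INF g\<in>C. g (c *\<^sub>R x)) \<le> c * (INF g\<in>C. g x)"
      using c by (simp add: field_simps)
  qed
qed

text \<open>
  A minimal sublinear functional coincides with each of its shears, and is therefore additive.
\<close>

lemma Hahn_Banach_sublinear:
  fixes h :: "'a::real_vector \<Rightarrow> real"
  assumes h: "sublinear h"
  shows "\<exists>g. linear g \<and> g \<le> h"
proof -
  let ?A = "{g. sublinear g \<and> g \<le> h}"
  \<comment> \<open>The order is reversed, so that the maximal element given by Zorn's lemma is a
    minimal sublinear functional.\<close>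
  let ?P = "\<lambda>f g :: 'a \<Rightarrow> real. g \<le> f"
  have "\<exists>m\<in>?A. \<forall>a\<in>?A. ?P m a \<longrightarrow> a = m"
  proof (rule predicate_Zorn)
    show "partial_order_on ?A (relation_of ?P ?A)"
      by (rule partial_order_on_relation_ofI) auto
  next
    fix C assume C: "C \<in> Chains (relation_of ?P ?A)"
    show "\<exists>u\<in>?A. \<forall>a\<in>C. ?P a u"
    proof (cases "C = {}")
      case True then show ?thesis using h by auto
    next
      case False
      have sub: "g \<in> C \<Longrightarrow> sublinear g" and le: "g \<in> C \<Longrightarrow> g \<le> h"
        and chain: "f \<in> C \<Longrightarrow> g \<in> C \<Longrightarrow> f \<le> g \<or> g \<le> f" for f g
        using C by (auto simp: Chains_def relation_of_def)
      let ?u = "\<lambda>x. INF g\<in>C. g x"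
      have u: "sublinear ?u" "\<And>g x. g \<in> C \<Longrightarrow> ?u x \<le> g x"
        using sublinear_cINF[OF False sub chain le] by blast+
      obtain g0 where "g0 \<in> C" using False by blast
      then have "?u \<le> h"
        using u(2) le by (force simp: le_fun_def intro: order_trans)
      then show ?thesis using u by (intro bexI[of _ ?u]) (auto simp: le_fun_def)
    qed
  qed
  then obtain g where g: "sublinear g" "g \<le> h"
    and min: "\<And>f. sublinear f \<Longrightarrow> f \<le> g \<Longrightarrow> f = g"
    using order_trans by blast
  have "shear g y = g" for y
    using shear_le_self[OF g(1), of y] by (intro min sublinear_shear g) (simp add: le_fun_def)
  then have add: "g (x + y) = g x + g y" for x y
    using shear_le[OF g(1), of 1 y x] sublinear_add[OF g(1), of x y] by simp
  have neg: "g (- x) = - g x" for x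
    using add[of x "- x"] sublinear_zero[OF g(1)] by simp
  have "g (c *\<^sub>R x) = c *\<^sub>R g x" for c x
  proof (cases "0 \<le> c")
    case False
    then show ?thesis
      using sublinear_scale[OF g(1), of "- c" x] neg[of "c *\<^sub>R x"] by simp
  qed (simp add: sublinear_scale[OF g(1)])
  then show ?thesis using add g(2) by (intro exI[of _ g]) (auto intro: linearI)
qed

text \<open>Instead of extending a functional from the line through \<open>x\<close>, Hahn-Banach is
  applied to \<open>shear norm x\<close>: domination at \<open>- x\<close> forces the value at
  \<open>x\<close> to be at least \<open>norm x\<close>.\<close>

lemma norming_functional:
  fixes x :: "'a::real_normed_vector"
  shows "\<exists>f. bounded_linear f \<and> (\<forall>y. \<bar>f y\<bar> \<le> norm y) \<and> f x = norm x"
proof -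
  obtain g where g: "linear g" "g \<le> shear norm x"
    using Hahn_Banach_sublinear[OF sublinear_shear[OF sublinear_norm, of x]] by blast
  have le: "g y \<le> norm y" for y
    using g(2) shear_le_self[OF sublinear_norm, of x y] by (force simp: le_fun_def intro: order_trans)
  have abs: "\<bar>g y\<bar> \<le> norm y" for y
    using le[of y] le[of "- y"] linear_neg[OF g(1), of y] by simp
  have "g (- x) \<le> shear norm x (- x)" using g(2) by (simp add: le_fun_def)
  also have "\<dots> \<le> - norm x" using shear_le[OF sublinear_norm, of 1 x "- x"] by simp
  finally have "g x = norm x"
    using le[of x] linear_neg[OF g(1), of x] by simp
  moreover have "bounded_linear g"
    using g(1) abs by (intro bounded_linear_intro[where K = 1]) (auto simp: linear_add linear_scale)
  ultimately show ?thesis using abs by blast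
qed

text \<open>Points of \<open>S\<close> act on the dual, which is a Banach space, and the closed sets
  \<open>F n\<close> cover it. A ball of radius r inside some \<open>F n\<close> contains its centre
  and the centre shifted by r times a norming functional of \<open>x\<close>; subtracting the two
  bounds gives the factor 2.\<close>

lemma weakly_bounded_imp_bounded:
  fixes S :: "'a::real_normed_vector set"
  assumes "\<And>f :: 'a \<Rightarrow> real. bounded_linear f \<Longrightarrow> \<exists>M. \<forall>x\<in>S. \<bar>f x\<bar> \<le> M"
  shows "\<exists>M. \<forall>x\<in>S. norm x \<le> M"
proof -
  define F :: "nat \<Rightarrow> ('a \<Rightarrow>\<^sub>L real) set" where "F n = {\<phi>. \<forall>x\<in>S. \<bar>blinfun_apply \<phi> x\<bar> \<le> n}" for n
  have "F n = (\<Inter>x\<in>S. {\<phi>. \<bar>blinfun_apply \<phi> x\<bar> \<le> n})" for n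
    by (auto simp: F_def)
  then have closed: "closed (F n)" for n
    by (auto intro!: closed_Collect_le continuous_intros)
  have "(\<Union>n. F n) = UNIV"
  proof safe
    fix \<phi> :: "'a \<Rightarrow>\<^sub>L real"
    obtain M where M: "\<And>x. x \<in> S \<Longrightarrow> \<bar>blinfun_apply \<phi> x\<bar> \<le> M"
      using assms[OF blinfun.bounded_linear_right] by blast
    obtain n :: nat where "M \<le> n" using real_arch_simple by blast
    then have "\<phi> \<in> F n" using M by (force simp: F_def intro: order_trans)
    then show "\<phi> \<in> (\<Union>n. F n)" by blast
  qed simp
  moreover have "interior (\<Union>n. F n) = {}" if "\<And>n. interior (F n) = {}"
    using Met_TC.metric_Baire_category_alt[of "range F"] that closed complete_UNIV by auto
  ultimately obtain n where "interior (F n) \<noteq> {}" by auto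
  then obtain \<phi> r where r: "0 < r" "cball \<phi> r \<subseteq> F n"
    by (meson all_not_in_conv mem_interior_cball)
  have "norm x \<le> 2 * n / r" if x: "x \<in> S" for x
  proof -
    obtain f where f: "bounded_linear f" "\<forall>y. \<bar>f y\<bar> \<le> norm y" "f x = norm x"
      using norming_functional by blast
    define \<psi> where "\<psi> = Blinfun f"
    have \<psi>: "blinfun_apply \<psi> = f" using f(1) by (simp add: \<psi>_def bounded_linear_Blinfun_apply)
    have "norm \<psi> \<le> 1" using f(2) by (intro norm_blinfun_bound) (auto simp: \<psi>)
    then have "norm (r *\<^sub>R \<psi>) \<le> r" using r(1) by simp
    then have "\<phi> + r *\<^sub>R \<psi> \<in> F n" "\<phi> \<in> F n"
      using r by (auto intro!: subsetD[OF r(2)] simp: dist_norm)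
    then have "\<bar>blinfun_apply \<phi> x + r * norm x\<bar> \<le> n" "\<bar>blinfun_apply \<phi> x\<bar> \<le> n"
      using x f(3) by (auto simp: F_def \<psi> plus_blinfun.rep_eq scaleR_blinfun.rep_eq)
    then have "r * norm x \<le> 2 * n" by linarith
    then show ?thesis using r(1) by (simp add: field_simps)
  qed
  then show ?thesis by blast
qed

section \<open>Operators and duals of normed-space records\<close>

context normed_space
begin

lemma metric_space: "Metric_space (vset E) (vdist E)"
  by (rule Metric_space_vdist) unfold_locales

lemma topspace_vtop: "topspace (vtop E) = vset E"
  unfolding vtop_def by (rule Metric_space.topspace_mtopology[OF metric_space])

lemma diff_closed: "x \<in> vset E \<Longrightarrow> y \<in> vset E \<Longrightarrow> vdiff E x y \<in> vset E"
  by (simp add: vdiff_def add_closed scale_closed)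

lemma scale_zero: "x \<in> vset E \<Longrightarrow> vscale E 0 x = vzero E"
  using norm_eq_zero[of "vscale E 0 x"] norm_scale[of x 0] by (simp add: scale_closed)

lemma zero_add: "x \<in> vset E \<Longrightarrow> vadd E (vzero E) x = x"
  using add_zero add_commute zero_closed by metis

lemma norm_zero: "vnorm E (vzero E) = 0"
  using norm_eq_zero zero_closed by blast

lemma vdist_zero: "x \<in> vset E \<Longrightarrow> vdist E (vzero E) x = vnorm E x"
  using norm_scale[of x "-1"]
  by (simp add: vdist_def vdiff_def zero_closed zero_add scale_closed)

lemma zero_in_unit_ball: "vzero E \<in> unit_ball E"
  by (simp add: unit_ball_def norm_zero zero_closed)

lemma normalize_in_unit_ball:
  assumes "x \<in> vset E" "vnorm E x \<noteq> 0"
  shows "vscale E (inverse (vnorm E x)) x \<in> unit_ball E"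
  using assms norm_nonneg[of x] by (simp add: unit_ball_def scale_closed norm_scale)

end

text \<open>The algebraic half of \<open>operator\<close>. Mapping into the carrier is stated
  explicitly here; in \<open>operator\<close> it is part of continuity.\<close>

definition linear_map :: "'a nspace \<Rightarrow> 'b nspace \<Rightarrow> ('a \<Rightarrow> 'b) \<Rightarrow> bool" where
  "linear_map E F T \<longleftrightarrow>
     (\<forall>x\<in>vset E. T x \<in> vset F) \<and>
     (\<forall>x\<in>vset E. \<forall>y\<in>vset E. T (vadd E x y) = vadd F (T x) (T y)) \<and>
     (\<forall>a. \<forall>x\<in>vset E. T (vscale E a x) = vscale F a (T x))"

lemma linear_map_closed: "linear_map E F T \<Longrightarrow> x \<in> vset E \<Longrightarrow> T x \<in> vset F"
  and linear_map_add:
    "linear_map E F T \<Longrightarrow> x \<in> vset E \<Longrightarrow> y \<in> vset E \<Longrightarrow> T (vadd E x y) = vadd F (T x) (T y)"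
  and linear_map_scale:
    "linear_map E F T \<Longrightarrow> x \<in> vset E \<Longrightarrow> T (vscale E a x) = vscale F a (T x)"
  by (auto simp: linear_map_def)

lemma linear_map_diff:
  assumes "normed_space E" "linear_map E F T" "x \<in> vset E" "y \<in> vset E"
  shows "T (vdiff E x y) = vdiff F (T x) (T y)"
  using assms by (simp add: vdiff_def linear_map_add linear_map_scale normed_space.scale_closed)

lemma linear_map_zero:
  assumes "normed_space E" "normed_space F" "linear_map E F T"
  shows "T (vzero E) = vzero F"
  using assms linear_map_scale[OF assms(3), of "vzero E" 0]
  by (simp add: normed_space.scale_zero normed_space.zero_closed linear_map_closed)

lemma operator_iff:
  assumes E: "normed_space E" and F: "normed_space F"
  shows "operator E F T \<longleftrightarrow>
    linear_map E F T \<and> (\<exists>K. \<forall>x\<in>vset E. vnorm F (T x) \<le> K * vnorm E x)"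
proof -
  interpret E: normed_space E by fact
  interpret F: normed_space F by fact
  note cont = Metric_space.metric_continuous_map[OF E.metric_space F.metric_space, of T,
      folded vtop_def]
  have diff: "vdist F (T x) (T y) = vnorm F (T (vdiff E x y))"
    if "linear_map E F T" "x \<in> vset E" "y \<in> vset E" for x y
    using that by (simp add: vdist_def linear_map_closed linear_map_diff[OF E])
  show ?thesis
  proof (intro iffI conjI)
    assume T: "operator E F T"
    then show lin: "linear_map E F T"
      using cont by (auto simp: operator_def linear_map_def)
    obtain d where d: "d > 0"
      and small: "\<And>x. x \<in> vset E \<Longrightarrow> vdist E (vzero E) x < d \<Longrightarrow> vdist F (T (vzero E)) (T x) < 1"
      using T cont E.zero_closed unfolding operator_def by (metis zero_less_one)
    have small': "vnorm F (T x) < 1" if "x \<in> vset E" "vnorm E x < d" for x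
      using small[of x] that linear_map_zero[OF E F lin] linear_map_closed[OF lin that(1)]
      by (simp add: E.vdist_zero F.vdist_zero)
    have "vnorm F (T x) \<le> (2 / d) * vnorm E x" if x: "x \<in> vset E" for x
    proof (cases "vnorm E x = 0")
      case True
      then have "x = vzero E" using E.norm_eq_zero x by blast
      then show ?thesis using linear_map_zero[OF E F lin] by (simp add: E.norm_zero F.norm_zero)
    next
      case False
      then have pos: "vnorm E x > 0" using E.norm_nonneg[OF x] by simp
      \<comment> \<open>Scales \<open>x\<close> to norm d/2, strictly inside the ball where
        \<open>T\<close> is known to be small.\<close>
      let ?c = "d / (2 * vnorm E x)"
      have "vnorm F (T (vscale E ?c x)) < 1"
        using pos d by (intro small') (simp_all add: E.scale_closed E.norm_scale x)
      then have "?c * vnorm F (T x) < 1"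
        using pos d x by (simp add: linear_map_scale[OF lin] F.norm_scale linear_map_closed[OF lin])
      then show ?thesis using pos d by (simp add: field_simps)
    qed
    then show "\<exists>K. \<forall>x\<in>vset E. vnorm F (T x) \<le> K * vnorm E x" by blast
  next
    assume "linear_map E F T \<and> (\<exists>K. \<forall>x\<in>vset E. vnorm F (T x) \<le> K * vnorm E x)"
    then obtain K where lin: "linear_map E F T"
      and K: "\<And>x. x \<in> vset E \<Longrightarrow> vnorm F (T x) \<le> K * vnorm E x" by blast
    \<comment> \<open>\<open>K\<close> may be zero or negative; a positive constant is needed as the
      divisor in the choice of delta.\<close>
    have K': "vnorm F (T x) \<le> (\<bar>K\<bar> + 1) * vnorm E x" if "x \<in> vset E" for x
    proof -
      have "K * vnorm E x \<le> (\<bar>K\<bar> + 1) * vnorm E x"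
        using E.norm_nonneg[OF that] by (intro mult_right_mono) auto
      then show ?thesis using K[OF that] by linarith
    qed
    have "continuous_map (vtop E) (vtop F) T"
      unfolding cont
    proof (intro conjI ballI allI impI)
      fix a e assume a: "a \<in> vset E" and e: "0 < (e::real)"
      show "\<exists>d>0. \<forall>x. x \<in> vset E \<and> vdist E a x < d \<longrightarrow> vdist F (T a) (T x) < e"
      proof (intro exI[of _ "e / (\<bar>K\<bar> + 1)"] conjI allI impI)
        fix x assume x: "x \<in> vset E \<and> vdist E a x < e / (\<bar>K\<bar> + 1)"
        have "vdist F (T a) (T x) \<le> (\<bar>K\<bar> + 1) * vdist E a x"
          using K'[of "vdiff E a x"] a x unfolding diff[OF lin a x[THEN conjunct1]]
          by (simp add: E.diff_closed vdist_def)
        also have "\<dots> < e" using x by (simp add: field_simps)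
        finally show "vdist F (T a) (T x) < e" .
      qed (use e in simp)
    qed (use lin in \<open>auto simp: linear_map_def\<close>)
    then show "operator E F T" using lin by (auto simp: operator_def linear_map_def)
  qed
qed

lemma operator_compose:
  assumes "operator E F S" "operator F G T"
    and "normed_space E" "normed_space F"
  shows "operator E G (\<lambda>x. T (S x))"
proof -
  have "S x \<in> vset F" if "x \<in> vset E" for x
    using assms that unfolding operator_iff[OF assms(3,4)] by (auto simp: linear_map_def)
  moreover have "continuous_map (vtop E) (vtop G) (T \<circ> S)"
    using assms continuous_map_compose unfolding operator_def by blast
  ultimately show ?thesis
    using assms by (auto simp: operator_def o_def)
qed

text \<open>Serves the adjoint, which agrees with the composition only on the carrier and is
  \<open>undefined\<close> elsewhere.\<close>

lemma operator_cong:
  assumes "operator E F S" "\<And>x. x \<in> vset E \<Longrightarrow> S x = T x" "normed_space E"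
  shows "operator E F T"
proof -
  have "continuous_map (vtop E) (vtop F) S" using assms(1) by (simp add: operator_def)
  then have "continuous_map (vtop E) (vtop F) T"
    by (rule continuous_map_eq) (simp add: assms(2) normed_space.topspace_vtop[OF assms(3)])
  moreover have "T (vadd E x y) = vadd F (T x) (T y)" if "x \<in> vset E" "y \<in> vset E" for x y
    using assms(1) that normed_space.add_closed[OF assms(3) that]
    by (simp add: operator_def flip: assms(2))
  moreover have "T (vscale E a x) = vscale F a (T x)" if "x \<in> vset E" for a x
    using assms(1) that normed_space.scale_closed[OF assms(3) that, of a]
    by (simp add: operator_def flip: assms(2))
  ultimately show ?thesis by (simp add: operator_def)
qed

lemma adjoint_op_in_dual:
  assumes "operator E F T" "f \<in> vset (dual F)" "normed_space E" "normed_space F"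
  shows "adjoint_op E T f \<in> vset (dual E)"
proof -
  have "operator E type_space (\<lambda>x. f (T x))"
    using operator_compose[OF assms(1), of type_space f] assms(2-4) by (simp add: dual_def)
  then have "operator E type_space (adjoint_op E T f)"
    by (rule operator_cong) (simp_all add: adjoint_op_def assms(3))
  then show ?thesis by (simp add: dual_def adjoint_op_def)
qed

section \<open>The dual of a record: norm, completeness, relative compactness\<close>

lemma dual_simps:
  "vset (dual E) = {f \<in> extensional (vset E). operator E type_space f}"
  "vzero (dual E) = (\<lambda>x\<in>vset E. 0)"
  "vadd (dual E) = (\<lambda>f g. \<lambda>x\<in>vset E. f x + g x)"
  "vscale (dual E) = (\<lambda>a f. \<lambda>x\<in>vset E. a * f x)"
  "vnorm (dual E) = (\<lambda>f. SUP x\<in>unit_ball E. \<bar>f x\<bar>)"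
  by (simp_all add: dual_def)

context normed_space
begin

lemma mem_dual_iff:
  "f \<in> vset (dual E) \<longleftrightarrow> f \<in> extensional (vset E) \<and>
     (\<forall>x\<in>vset E. \<forall>y\<in>vset E. f (vadd E x y) = f x + f y) \<and>
     (\<forall>a. \<forall>x\<in>vset E. f (vscale E a x) = a * f x) \<and>
     (\<exists>K. \<forall>x\<in>vset E. \<bar>f x\<bar> \<le> K * vnorm E x)"
  using operator_iff[OF normed_space_axioms normed_space_type_space, of f]
  by (auto simp: dual_simps linear_map_def)

lemma dual_add: "f \<in> vset (dual E) \<Longrightarrow> x \<in> vset E \<Longrightarrow> y \<in> vset E \<Longrightarrow> f (vadd E x y) = f x + f y"
  and dual_scale: "f \<in> vset (dual E) \<Longrightarrow> x \<in> vset E \<Longrightarrow> f (vscale E a x) = a * f x"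
  by (auto simp: mem_dual_iff)

lemma dual_diff:
  "f \<in> vset (dual E) \<Longrightarrow> x \<in> vset E \<Longrightarrow> y \<in> vset E \<Longrightarrow> f (vdiff E x y) = f x - f y"
  by (simp add: vdiff_def dual_add dual_scale scale_closed)

lemma dual_bdd_above:
  assumes "f \<in> vset (dual E)"
  shows "bdd_above ((\<lambda>x. \<bar>f x\<bar>) ` unit_ball E)"
proof -
  obtain K where K: "\<And>x. x \<in> vset E \<Longrightarrow> \<bar>f x\<bar> \<le> K * vnorm E x"
    using assms unfolding mem_dual_iff by blast
  show ?thesis
  proof (rule bdd_aboveI2)
    fix x assume "x \<in> unit_ball E"
    then have x: "x \<in> vset E" "vnorm E x \<le> 1" by (auto simp: unit_ball_def)
    then have "K * vnorm E x \<le> \<bar>K\<bar> * 1"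
      using norm_nonneg by (intro mult_mono) auto
    then show "\<bar>f x\<bar> \<le> \<bar>K\<bar>" using K[OF x(1)] by simp
  qed
qed

lemma dual_norm_upper:
  "f \<in> vset (dual E) \<Longrightarrow> x \<in> unit_ball E \<Longrightarrow> \<bar>f x\<bar> \<le> vnorm (dual E) f"
  unfolding dual_simps(5) using dual_bdd_above by (intro cSUP_upper) auto

lemma dual_norm_least:
  "(\<And>x. x \<in> unit_ball E \<Longrightarrow> \<bar>f x\<bar> \<le> K) \<Longrightarrow> vnorm (dual E) f \<le> K"
  unfolding dual_simps(5) using zero_in_unit_ball by (intro cSUP_least) auto

lemma dual_norm_nonneg: "f \<in> vset (dual E) \<Longrightarrow> 0 \<le> vnorm (dual E) f"
  using dual_norm_upper[OF _ zero_in_unit_ball] abs_ge_zero order_trans by blast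

lemma dual_zero: "f \<in> vset (dual E) \<Longrightarrow> f (vzero E) = 0"
  using dual_scale[of f "vzero E" 0] by (simp add: scale_zero zero_closed)

text \<open>Stated for homogeneous \<open>f\<close> instead of members of the dual, because
  \<open>memdualI\<close> uses it to establish membership.\<close>

lemma dual_bound:
  assumes f: "\<And>x a. x \<in> vset E \<Longrightarrow> f (vscale E a x) = a * f x"
    and K: "\<And>x. x \<in> unit_ball E \<Longrightarrow> \<bar>f x\<bar> \<le> K" and x: "x \<in> vset E"
  shows "\<bar>f x\<bar> \<le> K * vnorm E x"
proof (cases "vnorm E x = 0")
  case True
  then have "x = vzero E" using norm_eq_zero x by blast
  then show ?thesis using True f[of x 0] x by (simp add: scale_zero)
next
  case False
  then have "\<bar>f (vscale E (inverse (vnorm E x)) x)\<bar> \<le> K"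
    by (intro K normalize_in_unit_ball x)
  then show ?thesis using False norm_nonneg[OF x] f[OF x] by (simp add: abs_mult field_simps)
qed

lemma dual_norm_bound: "f \<in> vset (dual E) \<Longrightarrow> x \<in> vset E \<Longrightarrow> \<bar>f x\<bar> \<le> vnorm (dual E) f * vnorm E x"
  by (rule dual_bound) (auto simp: dual_scale dual_norm_upper)

lemma memdualI:
  assumes "f \<in> extensional (vset E)"
    and "\<And>x y. x \<in> vset E \<Longrightarrow> y \<in> vset E \<Longrightarrow> f (vadd E x y) = f x + f y"
    and "\<And>x a. x \<in> vset E \<Longrightarrow> f (vscale E a x) = a * f x"
    and "\<And>x. x \<in> unit_ball E \<Longrightarrow> \<bar>f x\<bar> \<le> K"
  shows "f \<in> vset (dual E)"
  unfolding mem_dual_iff using assms dual_bound[of f K] by blast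

lemma normed_space_dual: "normed_space (dual E)"
proof
  have ball: "x \<in> vset E" if "x \<in> unit_ball E" for x using that by (simp add: unit_ball_def)
  show "vzero (dual E) \<in> vset (dual E)"
    by (rule memdualI[where K = 0]) (auto simp: dual_simps add_closed scale_closed ball)
  show add: "vadd (dual E) f g \<in> vset (dual E)" if "f \<in> vset (dual E)" "g \<in> vset (dual E)" for f g
  proof (rule memdualI[where K = "vnorm (dual E) f + vnorm (dual E) g"])
    fix x assume "x \<in> unit_ball E"
    then show "\<bar>vadd (dual E) f g x\<bar> \<le> vnorm (dual E) f + vnorm (dual E) g"
      using dual_norm_upper[OF that(1)] dual_norm_upper[OF that(2)] ball
      by (force simp: dual_simps(3) intro: order_trans[OF abs_triangle_ineq add_mono])
  qed (use that in \<open>auto simp: dual_simps(2-4) add_closed scale_closed dual_add dual_scale algebra_simps\<close>)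
  show scale: "vscale (dual E) a f \<in> vset (dual E)" if "f \<in> vset (dual E)" for f a
  proof (rule memdualI[where K = "\<bar>a\<bar> * vnorm (dual E) f"])
    fix x assume "x \<in> unit_ball E"
    then show "\<bar>vscale (dual E) a f x\<bar> \<le> \<bar>a\<bar> * vnorm (dual E) f"
      using dual_norm_upper[OF that] ball
      by (simp add: dual_simps(4) abs_mult mult_left_mono)
  qed (use that in \<open>auto simp: dual_simps(2-4) add_closed scale_closed dual_add dual_scale algebra_simps\<close>)
  fix f g h a b assume f: "f \<in> vset (dual E)"
  have ext: "f \<in> extensional (vset E)" using f by (simp add: dual_simps)
  show "vadd (dual E) (vadd (dual E) f g) h = vadd (dual E) f (vadd (dual E) g h)"
    "vadd (dual E) f g = vadd (dual E) g f"
    "vscale (dual E) a (vadd (dual E) f g) = vadd (dual E) (vscale (dual E) a f) (vscale (dual E) a g)"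
    "vscale (dual E) (a + b) f = vadd (dual E) (vscale (dual E) a f) (vscale (dual E) b f)"
    "vscale (dual E) a (vscale (dual E) b f) = vscale (dual E) (a * b) f"
    by (auto simp: dual_simps fun_eq_iff algebra_simps)
  show "vadd (dual E) f (vzero (dual E)) = f" "vscale (dual E) 1 f = f"
    using ext by (auto simp: dual_simps fun_eq_iff restrict_def extensional_def)
  show "\<exists>g\<in>vset (dual E). vadd (dual E) f g = vzero (dual E)"
    using scale[OF f, of "-1"] by (intro bexI[of _ "vscale (dual E) (-1) f"]) (auto simp: dual_simps(2-4))
  show "0 \<le> vnorm (dual E) f" by (rule dual_norm_nonneg[OF f])
  show "vnorm (dual E) f = 0 \<longleftrightarrow> f = vzero (dual E)"
  proof
    assume "vnorm (dual E) f = 0"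
    then have "f x = 0" if "x \<in> vset E" for x using dual_norm_bound[OF f that] by simp
    then show "f = vzero (dual E)"
      using ext by (auto simp: dual_simps(2) fun_eq_iff extensional_def)
  next
    assume "f = vzero (dual E)"
    then have "vnorm (dual E) f \<le> 0" by (intro dual_norm_least) (auto simp: dual_simps(2) ball)
    then show "vnorm (dual E) f = 0" using dual_norm_nonneg[OF f] by simp
  qed
  have le: "vnorm (dual E) (vscale (dual E) a f) \<le> \<bar>a\<bar> * vnorm (dual E) f"
    if "f \<in> vset (dual E)" for a f
    using dual_norm_upper[OF that]
    by (intro dual_norm_least) (auto simp: dual_simps(4) ball abs_mult intro!: mult_left_mono)
  show "vnorm (dual E) (vscale (dual E) a f) = \<bar>a\<bar> * vnorm (dual E) f"
  proof (cases "a = 0")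
    case True
    then show ?thesis using le[OF f, of a] dual_norm_nonneg[OF scale[OF f, of a]] by simp
  next
    case False
    \<comment> \<open>Scaling back by \<open>inverse a\<close> turns the inequality
      \<open>le\<close> into the reverse inequality.\<close>
    have "vscale (dual E) (inverse a) (vscale (dual E) a f) = f"
      using False ext by (auto simp: dual_simps(4) fun_eq_iff restrict_def extensional_def)
    then have "\<bar>a\<bar> * vnorm (dual E) f \<le> vnorm (dual E) (vscale (dual E) a f)"
      using le[OF scale[OF f, of a], of "inverse a"] False by (simp add: field_simps)
    then show ?thesis using le[OF f, of a] by simp
  qed
  assume g: "g \<in> vset (dual E)"
  show "vnorm (dual E) (vadd (dual E) f g) \<le> vnorm (dual E) f + vnorm (dual E) g"
    using dual_norm_upper[OF f] dual_norm_upper[OF g]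
    by (intro dual_norm_least)
      (force simp: dual_simps(3) ball intro: order_trans[OF abs_triangle_ineq add_mono])
qed

lemma vdiff_dual: "x \<in> vset E \<Longrightarrow> vdiff (dual E) f g x = f x - g x"
  by (simp add: vdiff_def dual_simps)

text \<open>The dual metric is uniform distance on the unit ball. The non-strict form is the one
  that a supremum respects; strict radii are recovered later by halving.\<close>

lemma vdist_dual_le:
  assumes "f \<in> vset (dual E)" "g \<in> vset (dual E)"
  shows "vdist (dual E) f g \<le> e \<longleftrightarrow> (\<forall>x\<in>unit_ball E. \<bar>f x - g x\<bar> \<le> e)"
proof -
  interpret D: normed_space "dual E" by (rule normed_space_dual)
  have eq: "vdist (dual E) f g = vnorm (dual E) (vdiff (dual E) f g)"
    using assms by (simp add: vdist_def)
  have "\<bar>f x - g x\<bar> \<le> vdist (dual E) f g" if "x \<in> unit_ball E" for x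
    using dual_norm_upper[OF D.diff_closed[OF assms] that] that
    by (simp add: eq vdiff_dual unit_ball_def)
  then show ?thesis
    using dual_norm_least[of "vdiff (dual E) f g" e]
    by (force simp: eq vdiff_dual unit_ball_def)
qed

lemma mcomplete_dual: "Metric_space.mcomplete (vset (dual E)) (vdist (dual E))"
proof -
  interpret D: normed_space "dual E" by (rule normed_space_dual)
  interpret M: Metric_space "vset (dual E)" "vdist (dual E)" by (rule D.metric_space)
  show ?thesis
    unfolding M.mcomplete_def
  proof (intro allI impI)
    fix \<sigma> assume \<sigma>: "M.MCauchy \<sigma>"
    then have mem: "\<sigma> n \<in> vset (dual E)" for n by (auto simp: M.MCauchy_def)
    have cauchy: "\<exists>N. \<forall>m\<ge>N. \<forall>n\<ge>N. \<forall>x\<in>unit_ball E. \<bar>\<sigma> m x - \<sigma> n x\<bar> \<le> e" if "e > 0" for e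
      using \<sigma> that vdist_dual_le[OF mem mem] unfolding M.MCauchy_def by (metis less_imp_le)
    have conv: "convergent (\<lambda>n. \<sigma> n x)" if x: "x \<in> vset E" for x
    proof (cases "vnorm E x = 0")
      case True
      then have "x = vzero E" using norm_eq_zero x by blast
      then show ?thesis using dual_zero[OF mem] by (simp add: convergent_const)
    next
      case False
      \<comment> \<open>The Cauchy condition is uniform only on the unit ball, so convergence at
        \<open>x\<close> is obtained at its normalisation and scaled back.\<close>
      let ?y = "vscale E (inverse (vnorm E x)) x"
      have "Cauchy (\<lambda>n. \<sigma> n ?y)"
      proof (rule CauchyI)
        fix e :: real assume "0 < e"
        then obtain N where N: "\<forall>m\<ge>N. \<forall>n\<ge>N. \<forall>x\<in>unit_ball E. \<bar>\<sigma> m x - \<sigma> n x\<bar> \<le> e / 2"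
          using cauchy[of "e / 2"] half_gt_zero by blast
        have "norm (\<sigma> m ?y - \<sigma> n ?y) < e" if "m \<ge> N" "n \<ge> N" for m n
        proof -
          have "\<bar>\<sigma> m ?y - \<sigma> n ?y\<bar> \<le> e / 2"
            using N that normalize_in_unit_ball[OF x False] by blast
          then show ?thesis using \<open>0 < e\<close> unfolding real_norm_def by linarith
        qed
        then show "\<exists>N. \<forall>m\<ge>N. \<forall>n\<ge>N. norm (\<sigma> m ?y - \<sigma> n ?y) < e" by blast
      qed
      then have "convergent (\<lambda>n. vnorm E x * \<sigma> n ?y)"
        by (intro convergent_mult convergent_const) (simp add: Cauchy_convergent_iff)
      moreover have "vnorm E x * \<sigma> n ?y = \<sigma> n x" for n
        using False by (simp add: dual_scale[OF mem x])
      ultimately show ?thesis by simp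
    qed
    define f where "f = (\<lambda>x\<in>vset E. lim (\<lambda>n. \<sigma> n x))"
    have lim: "(\<lambda>n. \<sigma> n x) \<longlonglongrightarrow> f x" if "x \<in> vset E" for x
      using conv[OF that] that by (simp add: f_def convergent_LIMSEQ_iff)
    have close: "\<exists>N. \<forall>n\<ge>N. \<forall>x\<in>unit_ball E. \<bar>\<sigma> n x - f x\<bar> \<le> e" if e: "e > 0" for e
    proof -
      obtain N where N: "\<forall>m\<ge>N. \<forall>n\<ge>N. \<forall>x\<in>unit_ball E. \<bar>\<sigma> m x - \<sigma> n x\<bar> \<le> e"
        using cauchy[OF e] by blast
      have "\<bar>\<sigma> n x - f x\<bar> \<le> e" if "n \<ge> N" "x \<in> unit_ball E" for n x
      proof (rule Lim_bounded[where M = N])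
        show "(\<lambda>m. \<bar>\<sigma> n x - \<sigma> m x\<bar>) \<longlonglongrightarrow> \<bar>\<sigma> n x - f x\<bar>"
          using that(2) by (intro tendsto_intros lim) (simp add: unit_ball_def)
      qed (use N that in blast)
      then show ?thesis by blast
    qed
    have f: "f \<in> vset (dual E)"
    proof -
      \<comment> \<open>A single term within distance 1 of the limit on the unit ball bounds the
        limit there.\<close>
      obtain N where N: "\<forall>x\<in>unit_ball E. \<bar>\<sigma> N x - f x\<bar> \<le> 1" using close[OF zero_less_one] by blast
      show ?thesis
      proof (rule memdualI[where K = "vnorm (dual E) (\<sigma> N) + 1"])
        show "f \<in> extensional (vset E)" by (simp add: f_def)
        fix x y a assume x: "x \<in> vset E" and y: "y \<in> vset E"
        have "(\<lambda>n. \<sigma> n x + \<sigma> n y) \<longlonglongrightarrow> f (vadd E x y)"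
          using lim[OF add_closed[OF x y]] by (simp add: dual_add[OF mem x y])
        then show "f (vadd E x y) = f x + f y"
          using LIMSEQ_unique tendsto_add[OF lim[OF x] lim[OF y]] by blast
      next
        fix x a assume x: "x \<in> vset E"
        have "(\<lambda>n. a * \<sigma> n x) \<longlonglongrightarrow> f (vscale E a x)"
          using lim[OF scale_closed[OF x]] by (simp add: dual_scale[OF mem x])
        then show "f (vscale E a x) = a * f x"
          using LIMSEQ_unique tendsto_mult[OF tendsto_const lim[OF x]] by blast
      next
        fix x assume x: "x \<in> unit_ball E"
        show "\<bar>f x\<bar> \<le> vnorm (dual E) (\<sigma> N) + 1"
          using bspec[OF N x] dual_norm_upper[OF mem x, of N] by linarith
      qed
    qed
    have "limitin M.mtopology \<sigma> f sequentially"
      unfolding M.limitin_metric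
    proof (intro conjI allI impI f)
      fix e :: real assume "0 < e"
      then obtain N where "\<forall>n\<ge>N. \<forall>x\<in>unit_ball E. \<bar>\<sigma> n x - f x\<bar> \<le> e / 2"
        using close[of "e / 2"] half_gt_zero by blast
      then have "vdist (dual E) (\<sigma> n) f \<le> e / 2" if "n \<ge> N" for n
        using vdist_dual_le[OF mem f] that by blast
      then have "vdist (dual E) (\<sigma> n) f < e" if "n \<ge> N" for n
        using that \<open>0 < e\<close> by force
      then show "\<forall>\<^sub>F n in sequentially. \<sigma> n \<in> vset (dual E) \<and> vdist (dual E) (\<sigma> n) f < e"
        using mem unfolding eventually_sequentially by blast
    qed
    then show "\<exists>f. limitin M.mtopology \<sigma> f sequentially" by blast
  qed
qed

text \<open>Completeness of the dual turns relative compactness into total boundedness, with the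
  centres of the nets chosen in \<open>S\<close> itself.\<close>

lemma relatively_compact_dual_iff:
  assumes "S \<subseteq> vset (dual E)"
  shows "relatively_compact (dual E) S \<longleftrightarrow>
    (\<forall>e>0. \<exists>K. finite K \<and> K \<subseteq> S \<and> (\<forall>f\<in>S. \<exists>g\<in>K. \<forall>x\<in>unit_ball E. \<bar>f x - g x\<bar> \<le> e))"
proof -
  interpret D: normed_space "dual E" by (rule normed_space_dual)
  interpret M: Metric_space "vset (dual E)" "vdist (dual E)" by (rule D.metric_space)
  have "relatively_compact (dual E) S \<longleftrightarrow> M.mtotally_bounded S"
    unfolding relatively_compact_def vtop_def
    by (rule M.mtotally_bounded_eq_compact_closure_of[OF mcomplete_dual, symmetric])
  also have "\<dots> \<longleftrightarrow>
    (\<forall>e>0. \<exists>K. finite K \<and> K \<subseteq> S \<and> (\<forall>f\<in>S. \<exists>g\<in>K. \<forall>x\<in>unit_ball E. \<bar>f x - g x\<bar> \<le> e))"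
    unfolding M.mtotally_bounded_def
  proof (intro iffI allI impI)
    fix e :: real
    assume "0 < e" and *: "\<forall>e>0. \<exists>K. finite K \<and> K \<subseteq> S \<and> S \<subseteq> (\<Union>g\<in>K. M.mball g e)"
    obtain K where K: "finite K" "K \<subseteq> S" "S \<subseteq> (\<Union>g\<in>K. M.mball g e)"
      using *[rule_format, OF \<open>0 < e\<close>] by (elim exE conjE)
    have "\<exists>g\<in>K. \<forall>x\<in>unit_ball E. \<bar>f x - g x\<bar> \<le> e" if f: "f \<in> S" for f
    proof -
      obtain g where g: "g \<in> K" "f \<in> M.mball g e" using K(3) f by blast
      then have "vdist (dual E) f g \<le> e" by (simp add: M.in_mball M.commute)
      then show ?thesis using g vdist_dual_le[of f g e] f K(2) assms by blast
    qed
    then show "\<exists>K. finite K \<and> K \<subseteq> S \<and> (\<forall>f\<in>S. \<exists>g\<in>K. \<forall>x\<in>unit_ball E. \<bar>f x - g x\<bar> \<le> e)"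
      using K by blast
  next
    fix e :: real
    assume "0 < e" and *: "\<forall>e>0. \<exists>K. finite K \<and> K \<subseteq> S \<and>
      (\<forall>f\<in>S. \<exists>g\<in>K. \<forall>x\<in>unit_ball E. \<bar>f x - g x\<bar> \<le> e)"
    \<comment> \<open>Half the radius, since \<open>mball\<close> is open and the net estimate is
      not strict.\<close>
    obtain K where K: "finite K" "K \<subseteq> S"
      "\<forall>f\<in>S. \<exists>g\<in>K. \<forall>x\<in>unit_ball E. \<bar>f x - g x\<bar> \<le> e / 2"
      using *[rule_format, OF half_gt_zero[OF \<open>0 < e\<close>]] by (elim exE conjE)
    have "f \<in> (\<Union>g\<in>K. M.mball g e)" if f: "f \<in> S" for f
    proof -
      obtain g where g: "g \<in> K" "\<forall>x\<in>unit_ball E. \<bar>f x - g x\<bar> \<le> e / 2" using K(3) f by blast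
      have mem: "f \<in> vset (dual E)" "g \<in> vset (dual E)" using f g(1) K(2) assms by auto
      then have "vdist (dual E) f g \<le> e / 2" using g(2) vdist_dual_le by blast
      then have "f \<in> M.mball g e" using \<open>0 < e\<close> mem by (simp add: M.in_mball M.commute)
      then show ?thesis using g(1) by blast
    qed
    then show "\<exists>K. finite K \<and> K \<subseteq> S \<and> S \<subseteq> (\<Union>g\<in>K. M.mball g e)"
      using K by blast
  qed
  finally show ?thesis .
qed

end

text \<open>On the right the domain occurs only through the image of its unit ball. Operators with
  the same image of the ball thus have equally compact adjoints on \<open>A\<close>, and the nets
  can be taken among the functionals in \<open>A\<close>.\<close>

lemma relatively_compact_adjoint_iff:
  assumes E: "normed_space E" and F: "normed_space F"
    and T: "operator E F T" and A: "A \<subseteq> vset (dual F)"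
  shows "relatively_compact (dual E) (adjoint_op E T ` A) \<longleftrightarrow>
    (\<forall>e>0. \<exists>K. finite K \<and> K \<subseteq> A \<and>
       (\<forall>f\<in>A. \<exists>g\<in>K. \<forall>z\<in>T ` unit_ball E. \<bar>f z - g z\<bar> \<le> e))"
proof -
  have val: "adjoint_op E T f x = f (T x)" if "x \<in> unit_ball E" for f :: "_ \<Rightarrow> real" and x
    using that by (simp add: adjoint_op_def unit_ball_def)
  have "adjoint_op E T ` A \<subseteq> vset (dual E)"
    using adjoint_op_in_dual[OF T _ E F] A by blast
  then have "relatively_compact (dual E) (adjoint_op E T ` A) \<longleftrightarrow>
    (\<forall>e>0. \<exists>K. finite K \<and> K \<subseteq> adjoint_op E T ` A \<and>
       (\<forall>f\<in>A. \<exists>g\<in>K. \<forall>x\<in>unit_ball E. \<bar>f (T x) - g x\<bar> \<le> e))"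
    by (simp add: normed_space.relatively_compact_dual_iff[OF E] val)
  also have "\<dots> \<longleftrightarrow> (\<forall>e>0. \<exists>K. finite K \<and> K \<subseteq> A \<and>
       (\<forall>f\<in>A. \<exists>g\<in>K. \<forall>x\<in>unit_ball E. \<bar>f (T x) - g (T x)\<bar> \<le> e))"
    unfolding ex_finite_subset_image by (simp add: val)
  finally show ?thesis by simp
qed

section \<open>Sequence spaces\<close>

lemma ell_simps:
  "vset (ell q) = {a. summable (\<lambda>n. \<bar>a n\<bar> powr q)}"
  "vzero (ell q) = (\<lambda>n. 0)"
  "vadd (ell q) = (\<lambda>a b n. a n + b n)"
  "vscale (ell q) = (\<lambda>c a n. c * a n)"
  "vnorm (ell q) = (\<lambda>a. (\<Sum>n. \<bar>a n\<bar> powr q) powr (1 / q))"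
  by (simp_all add: ell_def)

lemma vdiff_ell: "vdiff (ell q) a b = (\<lambda>n. a n - b n)"
  by (simp add: vdiff_def ell_simps)

lemma powr_convex_comb:
  fixes q u v \<alpha> \<beta> :: real
  assumes "1 \<le> q" "0 \<le> u" "0 \<le> v" "0 \<le> \<alpha>" "0 \<le> \<beta>" "\<alpha> + \<beta> = 1"
  shows "(\<alpha> * u + \<beta> * v) powr q \<le> \<alpha> * u powr q + \<beta> * v powr q"
proof -
  \<comment> \<open>Covers the boundary case, in which \<open>u\<close> or \<open>v\<close> vanishes
    and the claim reduces to \<open>t powr q \<le> t\<close> on [0,1].\<close>
  have le: "(t * w) powr q \<le> t * w powr q" if "0 \<le> t" "t \<le> 1" "0 \<le> w" for t w :: real
  proof -
    have "t powr q \<le> t"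
      using that assms(1) powr_mono'[of 1 q t] by simp
    then show ?thesis using that by (simp add: powr_mult mult_right_mono)
  qed
  show ?thesis
  proof (cases "u = 0 \<or> v = 0")
    case True
    then show ?thesis using le[of \<alpha> u] le[of \<beta> v] assms by auto
  next
    case False
    have "\<alpha> = 1 - \<beta>" using assms(6) by simp
    then show ?thesis
      using convex_onD[OF powr_convex[OF assms(1)], of \<beta> u v] False assms(2-5) by simp
  qed
qed

context
  fixes q :: real
  assumes q: "1 \<le> q"
begin

lemma ell_norm_nonneg: "0 \<le> vnorm (ell q) a"
  by (simp add: ell_simps)

lemma ell_norm_powr:
  "a \<in> vset (ell q) \<Longrightarrow> vnorm (ell q) a powr q = (\<Sum>n. \<bar>a n\<bar> powr q)"
  using q by (simp add: ell_simps powr_powr suminf_nonneg)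

text \<open>Membership and norm bound are tested together on finite partial sums. Coordinatewise
  limits pass through such sums, and no summability has to be known beforehand.\<close>

lemma ell_norm_le_iff:
  assumes "0 \<le> r"
  shows "a \<in> vset (ell q) \<and> vnorm (ell q) a \<le> r \<longleftrightarrow> (\<forall>n. (\<Sum>j<n. \<bar>a j\<bar> powr q) \<le> r powr q)"
proof (intro iffI allI conjI)
  fix n assume a: "a \<in> vset (ell q) \<and> vnorm (ell q) a \<le> r"
  have "(\<Sum>j<n. \<bar>a j\<bar> powr q) \<le> (\<Sum>n. \<bar>a n\<bar> powr q)"
    using a by (intro sum_le_suminf) (auto simp: ell_simps)
  also have "\<dots> \<le> r powr q"
    using a q ell_norm_nonneg by (simp flip: ell_norm_powr) (intro powr_mono2, auto)
  finally show "(\<Sum>j<n. \<bar>a j\<bar> powr q) \<le> r powr q" .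
next
  assume *: "\<forall>n. (\<Sum>j<n. \<bar>a j\<bar> powr q) \<le> r powr q"
  then show a: "a \<in> vset (ell q)"
    unfolding ell_simps by (auto intro!: summableI_nonneg_bounded)
  then have "(\<Sum>n. \<bar>a n\<bar> powr q) \<le> r powr q"
    using * by (intro suminf_le_const) (auto simp: ell_simps)
  then have "(\<Sum>n. \<bar>a n\<bar> powr q) powr (1 / q) \<le> (r powr q) powr (1 / q)"
    using q a by (intro powr_mono2) (auto simp: ell_simps suminf_nonneg)
  then show "vnorm (ell q) a \<le> r"
    using q assms by (simp add: ell_simps powr_powr)
qed

lemma ell_coordinate_le: "a \<in> vset (ell q) \<Longrightarrow> \<bar>a n\<bar> \<le> vnorm (ell q) a"
proof -
  assume "a \<in> vset (ell q)"
  then have "(\<Sum>j<Suc n. \<bar>a j\<bar> powr q) \<le> vnorm (ell q) a powr q"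
    using ell_norm_le_iff[OF ell_norm_nonneg] by blast
  moreover have "\<bar>a n\<bar> powr q \<le> (\<Sum>j<Suc n. \<bar>a j\<bar> powr q)"
    by (simp add: sum_nonneg)
  ultimately have "\<bar>a n\<bar> powr q \<le> vnorm (ell q) a powr q" by linarith
  then show "\<bar>a n\<bar> \<le> vnorm (ell q) a"
    using q ell_norm_nonneg[of a] powr_less_mono2[of q "vnorm (ell q) a" "\<bar>a n\<bar>"] by force
qed

lemma ell_triangle:
  assumes "a \<in> vset (ell q)" "b \<in> vset (ell q)"
  shows "(\<lambda>n. a n + b n) \<in> vset (ell q)"
    and "vnorm (ell q) (\<lambda>n. a n + b n) \<le> vnorm (ell q) a + vnorm (ell q) b"
proof -
  \<comment> \<open>Minkowski by convexity: a + b is (s + t) times a convex combination of a/s and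
    b/t. Positive upper bounds s and t replace the norms, which may be zero; the excess is removed
    at the end.\<close>
  have *: "(\<lambda>n. a n + b n) \<in> vset (ell q) \<and> vnorm (ell q) (\<lambda>n. a n + b n) \<le> s + t"
    if s: "0 < s" "vnorm (ell q) a \<le> s" and t: "0 < t" "vnorm (ell q) b \<le> t" for s t
  proof -
    have pt: "\<bar>a j + b j\<bar> powr q \<le>
      (s + t) powr q * (s / (s + t) * (\<bar>a j\<bar> powr q / s powr q) + t / (s + t) * (\<bar>b j\<bar> powr q / t powr q))"
      for j
    proof -
      have "\<bar>a j + b j\<bar> powr q \<le> (\<bar>a j\<bar> + \<bar>b j\<bar>) powr q"
        using q by (intro powr_mono2) auto
      also have "\<bar>a j\<bar> + \<bar>b j\<bar> = (s + t) * (s / (s + t) * (\<bar>a j\<bar> / s) + t / (s + t) * (\<bar>b j\<bar> / t))"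
      proof -
        have "s / (s + t) * (\<bar>a j\<bar> / s) = \<bar>a j\<bar> / (s + t)" "t / (s + t) * (\<bar>b j\<bar> / t) = \<bar>b j\<bar> / (s + t)"
          using s t by simp_all
        then show ?thesis using s t by (simp flip: add_divide_distrib)
      qed
      also have "\<dots> powr q = (s + t) powr q * (s / (s + t) * (\<bar>a j\<bar> / s) + t / (s + t) * (\<bar>b j\<bar> / t)) powr q"
        by (rule powr_mult)
      also have "\<dots> \<le> (s + t) powr q * (s / (s + t) * (\<bar>a j\<bar> / s) powr q + t / (s + t) * (\<bar>b j\<bar> / t) powr q)"
        using s t q by (intro mult_left_mono powr_convex_comb) (auto simp flip: add_divide_distrib)
      finally show ?thesis using s t by (simp add: powr_divide)
    qed
    have "(\<Sum>j<n. \<bar>a j + b j\<bar> powr q) \<le> (s + t) powr q" for n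
    proof -
      have A: "(\<Sum>j<n. \<bar>a j\<bar> powr q) / s powr q \<le> 1"
        using ell_norm_le_iff[of s a] s assms(1) by simp
      have B: "(\<Sum>j<n. \<bar>b j\<bar> powr q) / t powr q \<le> 1"
        using ell_norm_le_iff[of t b] t assms(2) by simp
      have "(\<Sum>j<n. \<bar>a j + b j\<bar> powr q) \<le> (\<Sum>j<n.
        (s + t) powr q * (s / (s + t) * (\<bar>a j\<bar> powr q / s powr q) + t / (s + t) * (\<bar>b j\<bar> powr q / t powr q)))"
        by (intro sum_mono pt)
      also have "\<dots> = (s + t) powr q * (s / (s + t) * ((\<Sum>j<n. \<bar>a j\<bar> powr q) / s powr q)
          + t / (s + t) * ((\<Sum>j<n. \<bar>b j\<bar> powr q) / t powr q))"
        by (simp only: sum_distrib_left[symmetric] sum.distrib sum_divide_distrib)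
      also have "\<dots> \<le> (s + t) powr q * (s / (s + t) * 1 + t / (s + t) * 1)"
        using s t A B by (intro mult_left_mono add_mono) auto
      also have "\<dots> = (s + t) powr q"
        using s t by (simp flip: add_divide_distrib)
      finally show ?thesis .
    qed
    then show ?thesis using s t ell_norm_le_iff[of "s + t"] by simp
  qed
  show "(\<lambda>n. a n + b n) \<in> vset (ell q)"
    using *[of "vnorm (ell q) a + 1" "vnorm (ell q) b + 1"] ell_norm_nonneg
    by (simp add: add_nonneg_pos)
  show "vnorm (ell q) (\<lambda>n. a n + b n) \<le> vnorm (ell q) a + vnorm (ell q) b"
  proof (rule field_le_epsilon)
    fix e :: real assume "0 < e"
    then show "vnorm (ell q) (\<lambda>n. a n + b n) \<le> vnorm (ell q) a + vnorm (ell q) b + e"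
      using *[of "vnorm (ell q) a + e / 2" "vnorm (ell q) b + e / 2"] ell_norm_nonneg
      by (simp add: add_nonneg_pos)
  qed
qed

lemma ell_scale:
  assumes "a \<in> vset (ell q)"
  shows "(\<lambda>n. c * a n) \<in> vset (ell q)"
    and "vnorm (ell q) (\<lambda>n. c * a n) = \<bar>c\<bar> * vnorm (ell q) a"
proof -
  show "(\<lambda>n. c * a n) \<in> vset (ell q)"
    using assms by (auto simp: ell_simps abs_mult powr_mult intro: summable_mult)
  have "(\<Sum>n. \<bar>c * a n\<bar> powr q) = \<bar>c\<bar> powr q * (\<Sum>n. \<bar>a n\<bar> powr q)"
    using assms by (simp add: ell_simps abs_mult powr_mult suminf_mult)
  then show "vnorm (ell q) (\<lambda>n. c * a n) = \<bar>c\<bar> * vnorm (ell q) a"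
    using assms q by (simp add: ell_simps powr_mult suminf_nonneg powr_powr)
qed

lemma normed_space_ell: "normed_space (ell q)"
proof
  show "vzero (ell q) \<in> vset (ell q)" by (simp add: ell_simps)
next
  fix a b assume "a \<in> vset (ell q)" "b \<in> vset (ell q)"
  then show "vadd (ell q) a b \<in> vset (ell q)"
    "vnorm (ell q) (vadd (ell q) a b) \<le> vnorm (ell q) a + vnorm (ell q) b"
    using ell_triangle by (simp_all add: ell_simps(3))
next
  fix a c assume a: "a \<in> vset (ell q)"
  then show "vscale (ell q) c a \<in> vset (ell q)"
    "vnorm (ell q) (vscale (ell q) c a) = \<bar>c\<bar> * vnorm (ell q) a"
    using ell_scale by (simp_all add: ell_simps(4))
  show "\<exists>b\<in>vset (ell q). vadd (ell q) a b = vzero (ell q)"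
    using ell_scale(1)[OF a, of "-1"] by (intro bexI[of _ "\<lambda>n. -1 * a n"]) (auto simp: ell_simps(2,3))
  show "vnorm (ell q) a = 0 \<longleftrightarrow> a = vzero (ell q)"
    using ell_coordinate_le[OF a] q by (force simp: ell_simps(2,5))
qed (auto simp: ell_simps algebra_simps)

lemma mcomplete_ell: "Metric_space.mcomplete (vset (ell q)) (vdist (ell q))"
proof -
  interpret N: normed_space "ell q" by (rule normed_space_ell)
  interpret M: Metric_space "vset (ell q)" "vdist (ell q)" by (rule N.metric_space)
  show ?thesis
    unfolding M.mcomplete_def
  proof (intro allI impI)
    fix \<sigma> assume \<sigma>: "M.MCauchy \<sigma>"
    then have mem: "\<sigma> n \<in> vset (ell q)" for n by (auto simp: M.MCauchy_def)
    have dist: "vdist (ell q) (\<sigma> m) b = vnorm (ell q) (\<lambda>j. \<sigma> m j - b j)" if "b \<in> vset (ell q)" for m b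
      using mem that by (simp add: vdist_def vdiff_ell)
    have dmem: "(\<lambda>j. \<sigma> m j - b j) \<in> vset (ell q)" if "b \<in> vset (ell q)" for m b
      using N.diff_closed[OF mem that, of m] by (simp add: vdiff_ell)
    have cauchy: "\<exists>N. \<forall>m\<ge>N. \<forall>n\<ge>N. vnorm (ell q) (\<lambda>j. \<sigma> m j - \<sigma> n j) < e" if "e > 0" for e
      using \<sigma> that unfolding M.MCauchy_def by (simp add: dist[OF mem])
    have "convergent (\<lambda>n. \<sigma> n j)" for j
    proof -
      have "Cauchy (\<lambda>n. \<sigma> n j)"
      proof (rule CauchyI)
        fix e :: real assume "0 < e"
        then obtain N where N: "\<forall>m\<ge>N. \<forall>n\<ge>N. vnorm (ell q) (\<lambda>j. \<sigma> m j - \<sigma> n j) < e"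
          using cauchy by presburger
        have "norm (\<sigma> m j - \<sigma> n j) < e" if "m \<ge> N" "n \<ge> N" for m n
          using ell_coordinate_le[OF dmem[OF mem[of n], of m], of j] N that
          by (auto intro: le_less_trans)
        then show "\<exists>N. \<forall>m\<ge>N. \<forall>n\<ge>N. norm (\<sigma> m j - \<sigma> n j) < e" by blast
      qed
      then show ?thesis by (simp add: Cauchy_convergent_iff)
    qed
    then obtain a where a: "\<And>j. (\<lambda>n. \<sigma> n j) \<longlonglongrightarrow> a j"
      unfolding convergent_def by metis
    have close: "\<exists>N. \<forall>m\<ge>N. (\<lambda>j. \<sigma> m j - a j) \<in> vset (ell q) \<and> vnorm (ell q) (\<lambda>j. \<sigma> m j - a j) \<le> e"
      if e: "e > 0" for e
    proof -
      obtain N where N: "\<forall>m\<ge>N. \<forall>n\<ge>N. vnorm (ell q) (\<lambda>j. \<sigma> m j - \<sigma> n j) < e"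
        using cauchy[OF e] by blast
      \<comment> \<open>With m and k fixed, the Cauchy bound survives n tending to infinity because
        the sum is finite.\<close>
      have "(\<Sum>j<k. \<bar>\<sigma> m j - a j\<bar> powr q) \<le> e powr q" if m: "m \<ge> N" for m k
      proof (rule Lim_bounded[where M = N])
        show "(\<lambda>n. \<Sum>j<k. \<bar>\<sigma> m j - \<sigma> n j\<bar> powr q) \<longlonglongrightarrow> (\<Sum>j<k. \<bar>\<sigma> m j - a j\<bar> powr q)"
          using q by (intro tendsto_sum tendsto_powr2 tendsto_intros a) auto
        show "\<forall>n\<ge>N. (\<Sum>j<k. \<bar>\<sigma> m j - \<sigma> n j\<bar> powr q) \<le> e powr q"
          using ell_norm_le_iff[of e] e N m dmem[OF mem] by (metis less_imp_le)
      qed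
      then show ?thesis using ell_norm_le_iff[of e] e by (intro exI[of _ N]) auto
    qed
    obtain m where m: "(\<lambda>j. \<sigma> m j - a j) \<in> vset (ell q)"
      using close[OF zero_less_one] by blast
    \<comment> \<open>\<open>a\<close> is \<open>\<sigma> m\<close> minus the difference
      \<open>\<sigma> m - a\<close>, and both lie in the space.\<close>
    have amem: "a \<in> vset (ell q)"
      using N.diff_closed[OF mem[of m] m] by (simp add: vdiff_ell)
    have "limitin M.mtopology \<sigma> a sequentially"
      unfolding M.limitin_metric
    proof (intro conjI allI impI amem)
      fix e :: real assume "0 < e"
      then obtain N where N: "\<forall>m\<ge>N. vnorm (ell q) (\<lambda>j. \<sigma> m j - a j) \<le> e / 2"
        using close[of "e / 2"] half_gt_zero by blast
      have "vdist (ell q) (\<sigma> n) a < e" if "n \<ge> N" for n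
        using N[rule_format, OF that] \<open>0 < e\<close> by (simp add: dist[OF amem])
      then show "\<forall>\<^sub>F n in sequentially. \<sigma> n \<in> vset (ell q) \<and> vdist (ell q) (\<sigma> n) a < e"
        using mem unfolding eventually_sequentially by blast
    qed
    then show "\<exists>a. limitin M.mtopology \<sigma> a sequentially" by blast
  qed
qed

lemma banach_space_ell: "banach_space (ell q)"
  by (simp add: banach_space_def banach_space_axioms_def normed_space_ell mcomplete_ell)

end

section \<open>Subsequences in sequence spaces\<close>

text \<open>Tychonoff replaces the diagonal argument: the cube is compact in the product topology,
  and the first countability of a countable product yields subsequences.\<close>

lemma coordinatewise_convergent_subsequence:
  fixes x :: "nat \<Rightarrow> nat \<Rightarrow> real"
  assumes "\<And>k j. \<bar>x k j\<bar> \<le> 1"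
  shows "\<exists>r y. strict_mono (r :: nat \<Rightarrow> nat) \<and> (\<forall>j. (\<lambda>k. x (r k) j) \<longlonglongrightarrow> y j)"
proof -
  let ?K = "PiE UNIV (\<lambda>_::nat. {-1..1::real})"
  have "compactin (product_topology (\<lambda>_::nat. euclidean :: real topology) UNIV) ?K"
    by (simp add: compactin_PiE)
  then have "compact ?K"
    by (simp add: euclidean_product_topology)
  moreover have "x k \<in> ?K" for k
    using assms[of k] by (auto simp: abs_le_iff minus_le_iff)
  ultimately obtain y r where r: "strict_mono (r :: nat \<Rightarrow> nat)" "(x \<circ> r) \<longlonglongrightarrow> y"
    by (metis compact_imp_seq_compact seq_compactE)
  have "(\<lambda>k. x (r k) j) \<longlonglongrightarrow> y j" for j
    using continuous_on_tendsto_compose[OF continuous_on_product_coordinates r(2)]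
    by (simp add: o_def)
  then show ?thesis using r(1) by blast
qed

section \<open>Upper q-estimates and gliding humps\<close>

lemma powr_abs_sum_disjoint:
  fixes c :: "'i \<Rightarrow> real"
  assumes "finite I" and "\<And>i j. i \<in> I \<Longrightarrow> j \<in> I \<Longrightarrow> c i \<noteq> 0 \<Longrightarrow> c j \<noteq> 0 \<Longrightarrow> i = j"
  shows "\<bar>\<Sum>i\<in>I. c i\<bar> powr q = (\<Sum>i\<in>I. \<bar>c i\<bar> powr q)"
proof (cases "\<exists>i\<in>I. c i \<noteq> 0")
  case True
  then obtain i where i: "i \<in> I" "c i \<noteq> 0" by blast
  then have zero: "c j = 0" if "j \<in> I - {i}" for j using assms(2) that by blast
  then have "(\<Sum>j\<in>I. c j) = c i" "(\<Sum>j\<in>I. \<bar>c j\<bar> powr q) = \<bar>c i\<bar> powr q"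
    by (simp_all add: sum.remove[OF assms(1) i(1)])
  then show ?thesis by simp
qed simp

text \<open>The second identity makes the q-th powers of coefficients of size t^(p-1) equal to
  t^p.\<close>

lemma conjugate_exponent:
  fixes p q :: real
  assumes "1 < p" "1 / p + 1 / q = 1"
  shows "1 < q" and "(p - 1) * q = p"
proof -
  have "1 / q = (p - 1) / p" using assms by (simp add: diff_divide_distrib)
  then have q: "q = p / (p - 1)" by (metis divide_divide_eq_left' inverse_divide inverse_eq_divide inverse_inverse_eq mult_1)
  have "1 < p / (p - 1)" "(p - 1) * (p / (p - 1)) = p"
    using assms(1) by (simp_all add: field_simps)
  then show "1 < q" "(p - 1) * q = p" by (simp_all only: q)
qed

lemma dual_ell_sum:
  fixes z :: "nat \<Rightarrow> nat \<Rightarrow> real"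
  assumes q: "1 \<le> q" and f: "f \<in> vset (dual (ell q))" and z: "\<And>i. z i \<in> vset (ell q)"
  shows "(\<lambda>j. \<Sum>i<n. a i * z i j) \<in> vset (ell q) \<and> f (\<lambda>j. \<Sum>i<n. a i * z i j) = (\<Sum>i<n. a i * f (z i))"
proof -
  interpret normed_space "ell q" by (rule normed_space_ell[OF q])
  show ?thesis
  proof (induction n)
    case 0
    then show ?case using zero_closed dual_zero[OF f] by (simp add: ell_simps(2))
  next
    case (Suc n)
    have az: "(\<lambda>j. a n * z n j) \<in> vset (ell q)" "f (\<lambda>j. a n * z n j) = a n * f (z n)"
      using scale_closed[OF z, of "a n" n] dual_scale[OF f z, of "a n" n] by (simp_all add: ell_simps(4))
    then show ?case
      using Suc add_closed[of "\<lambda>j. \<Sum>i<n. a i * z i j" "\<lambda>j. a n * z n j"]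
        dual_add[OF f, of "\<lambda>j. \<Sum>i<n. a i * z i j" "\<lambda>j. a n * z n j"]
      by (simp add: ell_simps(3))
  qed
qed

text \<open>
  Testing the functional against the combination with coefficients
  \<open>sgn (f z\<^sub>i) \<bar>f z\<^sub>i\<bar>\<^sup>p\<^sup>-\<^sup>1\<close> bounds
  \<open>\<Sum> \<bar>f z\<^sub>i\<bar>\<^sup>p\<close> by a multiple of its own power with exponent \<open>1/q\<close>.
\<close>

lemma upper_estimate_imp_summable:
  fixes z :: "nat \<Rightarrow> nat \<Rightarrow> real"
  assumes pq: "1 < p" "1 / p + 1 / q = 1"
    and f: "f \<in> vset (dual (ell q))" and z: "\<And>i. z i \<in> vset (ell q)"
    and "0 \<le> C"
    and upper: "\<And>n a. vnorm (ell q) (\<lambda>j. \<Sum>i<n. a i * z i j) \<le> C * (\<Sum>i<n. \<bar>a i\<bar> powr q) powr (1 / q)"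
  shows "summable (\<lambda>i. \<bar>f (z i)\<bar> powr p)"
proof -
  have q: "1 \<le> q" "(p - 1) * q = p" using conjugate_exponent[OF pq] by simp_all
  interpret normed_space "ell q" by (rule normed_space_ell[OF q(1)])
  define a where "a i = sgn (f (z i)) * \<bar>f (z i)\<bar> powr (p - 1)" for i
  have aq: "\<bar>a i\<bar> powr q = \<bar>f (z i)\<bar> powr p" for i
    using q pq(1) by (simp add: a_def abs_mult powr_powr abs_sgn_eq)
  have af: "a i * f (z i) = \<bar>f (z i)\<bar> powr p" for i
  proof (cases "f (z i) = 0")
    case False
    have "a i * f (z i) = \<bar>f (z i)\<bar> powr (p - 1) * \<bar>f (z i)\<bar>"
      by (simp add: a_def abs_sgn mult.assoc mult.left_commute)
    also have "\<dots> = \<bar>f (z i)\<bar> powr p"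
      using False powr_add[of "\<bar>f (z i)\<bar>" "p - 1" 1] by simp
    finally show ?thesis .
  qed (simp add: a_def)
  let ?B = "vnorm (dual (ell q)) f * C"
  have "(\<Sum>i<n. \<bar>f (z i)\<bar> powr p) \<le> ?B powr p" for n
  proof -
    define S where "S = (\<Sum>i<n. \<bar>f (z i)\<bar> powr p)"
    have S0: "0 \<le> S" by (simp add: S_def sum_nonneg)
    note comb = dual_ell_sum[OF q(1) f, where z = z and a = a and n = n, OF z]
    have "S = f (\<lambda>j. \<Sum>i<n. a i * z i j)"
      using comb by (simp add: S_def af)
    also have "\<dots> \<le> vnorm (dual (ell q)) f * vnorm (ell q) (\<lambda>j. \<Sum>i<n. a i * z i j)"
      by (rule order_trans[OF abs_ge_self dual_norm_bound[OF f conjunct1[OF comb]]])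
    also have "\<dots> \<le> vnorm (dual (ell q)) f * (C * S powr (1 / q))"
      using upper[of a n] dual_norm_nonneg[OF f] by (intro mult_left_mono) (auto simp: aq S_def)
    finally have le: "S \<le> ?B * S powr (1 / q)" by (simp add: mult.assoc)
    \<comment> \<open>Since 1/p + 1/q = 1, cancelling \<open>S powr (1 / q)\<close> leaves this.
      Here \<open>S\<close> is a finite partial sum, so cancelling is legitimate, and the bound is
      independent of n.\<close>
    have "S powr (1 / p) \<le> ?B"
    proof (cases "S = 0")
      case False
      then have pos: "0 < S powr (1 / q)" by simp
      have "S powr (1 / p) * S powr (1 / q) = S"
        using pq False S0 by (simp flip: powr_add)
      then show ?thesis using le pos by (metis mult_le_cancel_right_pos)
    qed (use dual_norm_nonneg[OF f] \<open>0 \<le> C\<close> in simp)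
    then have "(S powr (1 / p)) powr p \<le> ?B powr p"
      using pq by (intro powr_mono2) auto
    then show ?thesis using pq S0 by (simp add: powr_powr S_def)
  qed
  then show ?thesis by (intro summableI_nonneg_bounded) auto
qed

text \<open>At each coordinate at most one block is nonzero, so the q-th power of the combination
  splits exactly into those of the blocks.\<close>

lemma blocks_upper_estimate:
  fixes u :: "nat \<Rightarrow> nat \<Rightarrow> real"
  assumes q: "1 \<le> q"
    and disj: "\<And>i k j. u i j \<noteq> 0 \<Longrightarrow> u k j \<noteq> 0 \<Longrightarrow> i = k"
    and u: "\<And>i. u i \<in> vset (ell q)" "\<And>i. vnorm (ell q) (u i) \<le> C"
  shows "vnorm (ell q) (\<lambda>j. \<Sum>i<n. a i * u i j) \<le> C * (\<Sum>i<n. \<bar>a i\<bar> powr q) powr (1 / q)"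
proof -
  have C: "0 \<le> C" by (rule order_trans[OF ell_norm_nonneg[OF q] u(2)])
  let ?S = "\<Sum>i<n. \<bar>a i\<bar> powr q"
  have "(\<Sum>j<m. \<bar>\<Sum>i<n. a i * u i j\<bar> powr q) \<le> (C * ?S powr (1 / q)) powr q" for m
  proof -
    have "(\<Sum>j<m. \<bar>\<Sum>i<n. a i * u i j\<bar> powr q) = (\<Sum>j<m. \<Sum>i<n. \<bar>a i * u i j\<bar> powr q)"
      using disj by (intro sum.cong refl powr_abs_sum_disjoint) auto
    also have "\<dots> = (\<Sum>i<n. \<bar>a i\<bar> powr q * (\<Sum>j<m. \<bar>u i j\<bar> powr q))"
      by (subst sum.swap) (simp add: abs_mult powr_mult sum_distrib_left)
    also have "\<dots> \<le> (\<Sum>i<n. \<bar>a i\<bar> powr q * C powr q)"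
      using ell_norm_le_iff[OF q C] u by (intro sum_mono mult_left_mono) auto
    also have "\<dots> = (C * ?S powr (1 / q)) powr q"
      using q by (simp add: powr_mult powr_powr sum_nonneg sum_distrib_left mult.commute)
    finally show ?thesis .
  qed
  moreover have "0 \<le> C * ?S powr (1 / q)" using C by simp
  ultimately show ?thesis using ell_norm_le_iff[OF q, of "C * ?S powr (1 / q)"] by blast
qed

lemma ell_subseq:
  assumes "(a :: nat \<Rightarrow> real) \<in> vset (ell p)" "strict_mono r"
  shows "(\<lambda>n. a (r n)) \<in> vset (ell p)"
proof -
  have "summable (\<lambda>n. \<bar>a n\<bar> powr p)" using assms(1) by (simp add: ell_simps)
  then have "summable ((\<lambda>n. \<bar>a n\<bar> powr p) \<circ> r)"
    by (rule summable_reindex) (use assms(2) strict_mono_imp_inj_on in auto)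
  then show ?thesis by (simp add: ell_simps o_def)
qed

lemma geometric_in_ell:
  assumes "1 \<le> p" "\<And>i. \<bar>a i\<bar> \<le> K * (1 / 2) ^ i"
  shows "a \<in> vset (ell p)"
proof -
  have K: "0 \<le> K" using assms(2)[of 0] by (simp add: order_trans[OF abs_ge_zero])
  have sum: "summable (\<lambda>i. K powr p * ((1 / 2) powr p) ^ i)"
    using assms(1) by (intro summable_mult summable_geometric) (simp add: powr01_less_one)
  have "\<bar>a i\<bar> powr p \<le> K powr p * ((1 / 2) powr p) ^ i" for i
  proof -
    have "\<bar>a i\<bar> powr p \<le> (K * (1 / 2) ^ i) powr p"
      using assms by (intro powr_mono2) auto
    also have "\<dots> = K powr p * ((1 / 2) powr p) ^ i"
      using K by (simp add: powr_mult powr_powr mult.commute flip: powr_realpow)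
    finally show ?thesis .
  qed
  then have "summable (\<lambda>i. \<bar>a i\<bar> powr p)"
    by (intro summable_comparison_test'[OF sum, of 0]) simp
  then show ?thesis by (simp add: ell_simps)
qed

text \<open>Gliding hump: \<open>z (r i)\<close> is concentrated on the interval from
  \<open>N i\<close> to \<open>N (Suc i)\<close>. The coordinatewise limit makes the head small for
  a late index, and membership in \<open>ell q\<close> makes the tail small after a late cut. Errors
  are measured in q-th powers, which add over disjoint index sets.\<close>

lemma block_subsequence:
  fixes z :: "nat \<Rightarrow> nat \<Rightarrow> real" and \<delta> :: "nat \<Rightarrow> real"
  assumes q: "1 \<le> q" and z: "\<And>k. z k \<in> vset (ell q)"
    and lim: "\<And>j. (\<lambda>k. z k j) \<longlonglongrightarrow> 0" and \<delta>: "\<And>n. 0 < \<delta> n"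
  shows "\<exists>(r :: nat \<Rightarrow> nat) N :: nat \<Rightarrow> nat. strict_mono r \<and> mono N \<and>
    (\<forall>i. (\<Sum>j<N i. \<bar>z (r i) j\<bar> powr q) \<le> \<delta> i \<and>
         (\<forall>m. (\<Sum>j=N (Suc i)..<m. \<bar>z (r i) j\<bar> powr q) \<le> \<delta> i))"
proof -
  \<comment> \<open>A state pairs an index with the cut chosen after it. \<open>P\<close> controls
    the tail beyond the cut; \<open>Q\<close> makes the next vector small before the present
    cut.\<close>
  define P where "P n s \<longleftrightarrow> (\<forall>m. (\<Sum>j=snd s..<m. \<bar>z (fst s) j\<bar> powr q) \<le> \<delta> n)"
    for n and s :: "nat \<times> nat"
  define Q where "Q n s t \<longleftrightarrow> fst s < fst t \<and> snd s \<le> snd t \<and>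
      (\<Sum>j<snd s. \<bar>z (fst t) j\<bar> powr q) \<le> \<delta> (Suc n)" for n and s t :: "nat \<times> nat"
  have tail: "\<exists>M\<ge>M0. P n (k, M)" for n k M0
  proof -
    have "summable (\<lambda>j. \<bar>z k j\<bar> powr q)" using z by (simp add: ell_simps)
    then obtain M where M: "\<forall>m\<ge>M. \<forall>n'. norm (\<Sum>j=m..<n'. \<bar>z k j\<bar> powr q) < \<delta> n"
      using \<delta>[of n] unfolding summable_Cauchy by blast
    have "(\<Sum>j=max M M0..<m. \<bar>z k j\<bar> powr q) \<le> \<delta> n" for m
      using M[rule_format, of "max M M0" m] by simp
    then show ?thesis by (intro exI[of _ "max M M0"]) (simp add: P_def)
  qed
  have "\<exists>s. \<forall>n. P n (s n) \<and> Q n (s n) (s (Suc n))"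
  proof (rule dependent_nat_choice)
    show "\<exists>s. P 0 s" using tail by blast
  next
    fix s :: "nat \<times> nat" and n
    have "(\<lambda>k. \<Sum>j<snd s. \<bar>z k j\<bar> powr q) \<longlonglongrightarrow> (\<Sum>j<snd s. \<bar>0\<bar> powr q)"
      using q by (intro tendsto_sum tendsto_powr2 tendsto_rabs lim tendsto_const) auto
    then have "(\<lambda>k. \<Sum>j<snd s. \<bar>z k j\<bar> powr q) \<longlonglongrightarrow> 0" by simp
    then have "\<forall>\<^sub>F k in sequentially. (\<Sum>j<snd s. \<bar>z k j\<bar> powr q) < \<delta> (Suc n)"
      using \<delta> by (rule order_tendstoD)
    then obtain k where k: "fst s < k" "(\<Sum>j<snd s. \<bar>z k j\<bar> powr q) < \<delta> (Suc n)"
      unfolding eventually_sequentially by (metis le_Suc_eq less_Suc_eq_le max.cobounded1 max.cobounded2)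
    obtain M where "snd s \<le> M" "P (Suc n) (k, M)" using tail by blast
    then show "\<exists>t. P (Suc n) t \<and> Q n s t"
      using k by (intro exI[of _ "(k, M)"]) (simp add: Q_def)
  qed
  then obtain s where s: "\<And>n. P n (s n)" "\<And>n. Q n (s n) (s (Suc n))" by blast
  \<comment> \<open>Shifted by one, so that the cut chosen after the i-th vector is
    \<open>N (Suc i)\<close>; the first head is empty because \<open>N 0 = 0\<close>.\<close>
  define N where "N i = (case i of 0 \<Rightarrow> 0 | Suc i' \<Rightarrow> snd (s i'))" for i
  have "strict_mono (\<lambda>i. fst (s i))"
    using s(2) by (simp add: strict_mono_Suc_iff Q_def)
  moreover have "mono N"
    using s(2) by (auto simp: mono_iff_le_Suc N_def Q_def split: nat.split)
  moreover have "(\<Sum>j<N i. \<bar>z (fst (s i)) j\<bar> powr q) \<le> \<delta> i" for i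
    using s(2) \<delta>[of i] by (cases i) (auto simp: N_def Q_def)
  moreover have "(\<Sum>j=N (Suc i)..<m. \<bar>z (fst (s i)) j\<bar> powr q) \<le> \<delta> i" for i m
    using s(1) by (simp add: N_def P_def)
  ultimately show ?thesis by (intro exI[of _ "\<lambda>i. fst (s i)"] exI[of _ N]) blast
qed

text \<open>Along the subsequence each vector splits into a block \<open>u i\<close> and a remainder
  \<open>v i\<close>. A functional has p-summable values on the blocks by the upper estimate, and on
  the remainders by geometric decay.\<close>

lemma ell_null_subsequence:
  fixes z :: "nat \<Rightarrow> nat \<Rightarrow> real"
  assumes pq: "1 < p" "1 / p + 1 / q = 1"
    and z: "\<And>k. z k \<in> vset (ell q)" "\<And>k. vnorm (ell q) (z k) \<le> C"
    and lim: "\<And>j. (\<lambda>k. z k j) \<longlonglongrightarrow> 0"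
  shows "\<exists>r :: nat \<Rightarrow> nat. strict_mono r \<and> weakly_p_summable p (ell q) (\<lambda>i. z (r i))"
proof -
  have q: "1 \<le> q" using conjugate_exponent[OF pq] by simp
  interpret normed_space "ell q" by (rule normed_space_ell[OF q])
  have C: "0 \<le> C" by (rule order_trans[OF ell_norm_nonneg[OF q] z(2)])
  \<comment> \<open>Head and tail together contribute twice this amount, so the remainder has norm
    at most \<open>(1 / 2) ^ i\<close>.\<close>
  let ?\<delta> = "\<lambda>i. ((1 / 2) ^ i) powr q / 2 :: real"
  obtain r N where r: "strict_mono (r :: nat \<Rightarrow> nat)" and N: "mono (N :: nat \<Rightarrow> nat)"
    and head: "\<And>i. (\<Sum>j<N i. \<bar>z (r i) j\<bar> powr q) \<le> ?\<delta> i"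
    and tail: "\<And>i m. (\<Sum>j=N (Suc i)..<m. \<bar>z (r i) j\<bar> powr q) \<le> ?\<delta> i"
    using block_subsequence[OF q z(1) lim, of ?\<delta>] by auto
  define u where "u i j = (if N i \<le> j \<and> j < N (Suc i) then z (r i) j else 0)" for i j
  define v where "v i j = (if N i \<le> j \<and> j < N (Suc i) then 0 else z (r i) j)" for i j
  have "u i \<in> vset (ell q) \<and> vnorm (ell q) (u i) \<le> C" for i
  proof -
    have "(\<Sum>j<m. \<bar>u i j\<bar> powr q) \<le> (\<Sum>j<m. \<bar>z (r i) j\<bar> powr q)" for m
      by (intro sum_mono) (simp add: u_def)
    then show ?thesis
      using ell_norm_le_iff[OF q C, of "u i"] ell_norm_le_iff[OF q C, of "z (r i)"] z[of "r i"]
      by (auto intro: order_trans)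
  qed
  then have u: "u i \<in> vset (ell q)" "vnorm (ell q) (u i) \<le> C" for i by auto
  have "v i \<in> vset (ell q) \<and> vnorm (ell q) (v i) \<le> (1 / 2) ^ i" for i
  proof -
    have "(\<Sum>j<m. \<bar>v i j\<bar> powr q) \<le> ((1 / 2) ^ i) powr q" for m
    proof -
      let ?J = "{..<N i} \<union> {N (Suc i)..<m}"
      have "(\<Sum>j<m. \<bar>v i j\<bar> powr q) = (\<Sum>j\<in>{..<m} \<inter> ?J. \<bar>v i j\<bar> powr q)"
        by (rule sum.mono_neutral_right) (auto simp: v_def)
      also have "\<dots> \<le> (\<Sum>j\<in>?J. \<bar>v i j\<bar> powr q)"
        by (rule sum_mono2) auto
      also have "\<dots> \<le> (\<Sum>j<N i. \<bar>v i j\<bar> powr q) + (\<Sum>j=N (Suc i)..<m. \<bar>v i j\<bar> powr q)"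
        by (simp add: sum_Un sum_nonneg)
      also have "\<dots> \<le> (\<Sum>j<N i. \<bar>z (r i) j\<bar> powr q) + (\<Sum>j=N (Suc i)..<m. \<bar>z (r i) j\<bar> powr q)"
        by (intro add_mono sum_mono) (simp_all add: v_def)
      also have "\<dots> \<le> ?\<delta> i + ?\<delta> i" by (intro add_mono head tail)
      finally show ?thesis by simp
    qed
    then show ?thesis using ell_norm_le_iff[OF q] by simp
  qed
  then have v: "v i \<in> vset (ell q)" "vnorm (ell q) (v i) \<le> (1 / 2) ^ i" for i by auto
  have uv: "z (r i) = vadd (ell q) (u i) (v i)" for i
    by (auto simp: ell_simps(3) u_def v_def)
  have disj: "i = k" if "u i j \<noteq> 0" "u k j \<noteq> 0" for i k j
  proof (rule ccontr)
    assume "i \<noteq> k"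
    then have "Suc i \<le> k \<or> Suc k \<le> i" by linarith
    moreover have "N i \<le> j" "j < N (Suc i)" "N k \<le> j" "j < N (Suc k)"
      using that by (auto simp: u_def split: if_splits)
    ultimately show False using monoD[OF N] by (meson le_trans not_le)
  qed
  have "(\<lambda>i. f (z (r i))) \<in> vset (ell p)" if f: "f \<in> vset (dual (ell q))" for f
  proof -
    have "(\<lambda>i. f (u i)) \<in> vset (ell p)"
      using upper_estimate_imp_summable[OF pq f u(1) C blocks_upper_estimate[OF q disj u]]
      by (simp add: ell_simps)
    moreover have "(\<lambda>i. f (v i)) \<in> vset (ell p)"
    proof (rule geometric_in_ell)
      fix i
      have "\<bar>f (v i)\<bar> \<le> vnorm (dual (ell q)) f * vnorm (ell q) (v i)"
        by (rule dual_norm_bound[OF f v(1)])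
      also have "\<dots> \<le> vnorm (dual (ell q)) f * (1 / 2) ^ i"
        by (intro mult_left_mono v(2) dual_norm_nonneg[OF f])
      finally show "\<bar>f (v i)\<bar> \<le> vnorm (dual (ell q)) f * (1 / 2) ^ i" .
    qed (use pq in simp)
    ultimately show ?thesis
      using ell_triangle(1)[of p] pq(1) by (simp add: uv dual_add[OF f u(1) v(1)])
  qed
  then have "weakly_p_summable p (ell q) (\<lambda>i. z (r i))"
    using z(1) by (auto simp: weakly_p_summable_def)
  then show ?thesis using r by blast
qed

section \<open>Stability of weak p-summability, and weak-p-precompactness of the unit ball of
  \<open>ell q\<close>\<close>

lemma weakly_p_summable_subseq:
  assumes "weakly_p_summable p E x" "strict_mono r"
  shows "weakly_p_summable p E (\<lambda>n. x (r n))"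
  using assms ell_subseq[OF _ assms(2), of "\<lambda>n. f (x n)" p for f]
  by (auto simp: weakly_p_summable_def)

lemma weakly_p_summable_diff:
  assumes p: "1 \<le> p" and E: "normed_space E"
    and x: "weakly_p_summable p E x" and y: "weakly_p_summable p E y"
  shows "weakly_p_summable p E (\<lambda>n. vdiff E (x n) (y n))"
  unfolding weakly_p_summable_def
proof (intro conjI ballI)
  have mem: "x n \<in> vset E" "y n \<in> vset E" for n
    using x y by (auto simp: weakly_p_summable_def)
  then show "range (\<lambda>n. vdiff E (x n) (y n)) \<subseteq> vset E"
    using normed_space.diff_closed[OF E] by auto
  fix f assume f: "f \<in> vset (dual E)"
  then have "(\<lambda>n. f (x n)) \<in> vset (ell p)" "(\<lambda>n. f (y n)) \<in> vset (ell p)"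
    using x y by (auto simp: weakly_p_summable_def)
  then show "(\<lambda>n. f (vdiff E (x n) (y n))) \<in> vset (ell p)"
    using normed_space.diff_closed[OF normed_space_ell[OF p]]
    by (simp add: vdiff_ell normed_space.dual_diff[OF E f mem])
qed

lemma WPC_ell:
  assumes pq: "1 < p" "1 / p + 1 / q = 1"
  shows "WPC p (ell q)"
proof -
  have q: "1 \<le> q" using conjugate_exponent[OF pq] by simp
  interpret normed_space "ell q" by (rule normed_space_ell[OF q])
  have "\<exists>r :: nat \<Rightarrow> nat. strict_mono r \<and> weakly_p_Cauchy p (ell q) (x \<circ> r)"
    if ball: "range x \<subseteq> unit_ball (ell q)" for x
  proof -
    have x: "x k \<in> vset (ell q)" "vnorm (ell q) (x k) \<le> 1" for k
      using ball by (auto simp: unit_ball_def)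
    have "\<bar>x k j\<bar> \<le> 1" for k j
      by (rule order_trans[OF ell_coordinate_le[OF q x(1)] x(2)])
    then obtain r y where r: "strict_mono (r :: nat \<Rightarrow> nat)"
      and y: "\<And>j. (\<lambda>k. x (r k) j) \<longlonglongrightarrow> y j"
      using coordinatewise_convergent_subsequence[of x] by blast
    \<comment> \<open>The coordinatewise limit stays in the unit ball, so subtracting it keeps the
      sequence in \<open>ell q\<close> and bounded by 2.\<close>
    have "(\<Sum>j<n. \<bar>y j\<bar> powr q) \<le> 1 powr q" for n
    proof (rule Lim_bounded[where M = 0])
      show "(\<lambda>k. \<Sum>j<n. \<bar>x (r k) j\<bar> powr q) \<longlonglongrightarrow> (\<Sum>j<n. \<bar>y j\<bar> powr q)"
        using q by (intro tendsto_sum tendsto_powr2 tendsto_intros y) auto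
      show "\<forall>k\<ge>0. (\<Sum>j<n. \<bar>x (r k) j\<bar> powr q) \<le> 1 powr q"
        using ell_norm_le_iff[OF q zero_le_one] x by blast
    qed
    then have y': "y \<in> vset (ell q)" "vnorm (ell q) y \<le> 1"
      using ell_norm_le_iff[OF q zero_le_one] by auto
    define z where "z k = vdiff (ell q) (x (r k)) y" for k
    have z: "z k \<in> vset (ell q)" for k
      by (simp add: z_def diff_closed x y')
    have "vnorm (ell q) (z k) \<le> 2" for k
      using norm_triangle[OF x(1) scale_closed[OF y'(1)], of "r k" "-1"]
        norm_scale[OF y'(1), of "-1"] x(2)[of "r k"] y'(2)
      by (simp add: z_def vdiff_def)
    moreover have "(\<lambda>k. z k j) \<longlonglongrightarrow> 0" for j
      using tendsto_diff[OF y tendsto_const, of j "y j"] by (simp add: z_def vdiff_ell)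
    ultimately obtain s where s: "strict_mono (s :: nat \<Rightarrow> nat)"
      and sum: "weakly_p_summable p (ell q) (\<lambda>i. z (s i))"
      using ell_null_subsequence[OF pq, of z 2, OF z] by blast
    have "weakly_p_Cauchy p (ell q) (x \<circ> (r \<circ> s))"
      unfolding weakly_p_Cauchy_def
    proof (intro conjI allI impI)
      show "range (x \<circ> (r \<circ> s)) \<subseteq> vset (ell q)" using x by auto
      fix n m :: "nat \<Rightarrow> nat" assume nm: "strict_mono n" "strict_mono m"
      \<comment> \<open>The limit \<open>y\<close> cancels: differences of the original terms are
        differences of two weakly p-summable subsequences.\<close>
      have "vdiff (ell q) ((x \<circ> (r \<circ> s)) (n k)) ((x \<circ> (r \<circ> s)) (m k)) =
          vdiff (ell q) (z (s (n k))) (z (s (m k)))" for k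
        by (simp add: z_def vdiff_ell)
      then show "weakly_p_summable p (ell q)
          (\<lambda>k. vdiff (ell q) ((x \<circ> (r \<circ> s)) (n k)) ((x \<circ> (r \<circ> s)) (m k)))"
        using weakly_p_summable_diff[OF less_imp_le[OF pq(1)] normed_space_axioms
            weakly_p_summable_subseq[OF sum nm(1)] weakly_p_summable_subseq[OF sum nm(2)]]
        by simp
    qed
    then show ?thesis using r s strict_mono_o by blast
  qed
  moreover have "operator (ell q) (ell q) (\<lambda>x. x)"
    by (simp add: operator_def)
  ultimately show ?thesis
    by (auto simp: WPC_def weakly_p_precompact_op_def weakly_p_precompact_def unit_ball_def)
qed

section \<open>Images under operators and isometric copies\<close>

lemma weakly_p_summable_image:
  assumes E: "normed_space E" and F: "normed_space F" and T: "operator E F T"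
    and x: "weakly_p_summable p E x"
  shows "weakly_p_summable p F (\<lambda>n. T (x n))"
  unfolding weakly_p_summable_def
proof (intro conjI ballI)
  have mem: "x n \<in> vset E" for n using x by (auto simp: weakly_p_summable_def)
  then show "range (\<lambda>n. T (x n)) \<subseteq> vset F"
    using T unfolding operator_iff[OF E F] by (auto simp: linear_map_def)
  fix f assume "f \<in> vset (dual F)"
  then have "adjoint_op E T f \<in> vset (dual E)" by (rule adjoint_op_in_dual[OF T _ E F])
  then have "(\<lambda>n. adjoint_op E T f (x n)) \<in> vset (ell p)"
    using x by (auto simp: weakly_p_summable_def)
  then show "(\<lambda>n. f (T (x n))) \<in> vset (ell p)"
    using mem by (simp add: adjoint_op_def)
qed

lemma weakly_p_Cauchy_image:
  assumes E: "normed_space E" and F: "normed_space F" and T: "operator E F T"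
    and x: "weakly_p_Cauchy p E x"
  shows "weakly_p_Cauchy p F (\<lambda>n. T (x n))"
  unfolding weakly_p_Cauchy_def
proof (intro conjI allI impI)
  have lin: "linear_map E F T" using T operator_iff[OF E F] by blast
  have mem: "x n \<in> vset E" for n using x by (auto simp: weakly_p_Cauchy_def)
  then show "range (\<lambda>n. T (x n)) \<subseteq> vset F"
    using linear_map_closed[OF lin] by auto
  fix n m :: "nat \<Rightarrow> nat" assume "strict_mono n" "strict_mono m"
  then have "weakly_p_summable p E (\<lambda>k. vdiff E (x (n k)) (x (m k)))"
    using x by (auto simp: weakly_p_Cauchy_def)
  then show "weakly_p_summable p F (\<lambda>k. vdiff F (T (x (n k))) (T (x (m k))))"
    using weakly_p_summable_image[OF E F T, of p "\<lambda>k. vdiff E (x (n k)) (x (m k))"]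
    by (simp add: linear_map_diff[OF E lin mem mem])
qed

lemma WPC_imp_weakly_p_precompact_op:
  assumes E: "normed_space E" and F: "normed_space F" and T: "operator E F T"
    and "WPC p E"
  shows "weakly_p_precompact_op p E F T"
proof -
  have "\<exists>r :: nat \<Rightarrow> nat. strict_mono r \<and> weakly_p_Cauchy p F (y \<circ> r)"
    if y: "range y \<subseteq> T ` unit_ball E" for y
  proof -
    have "\<forall>n. \<exists>x. x \<in> unit_ball E \<and> y n = T x" using y by blast
    then obtain x where x: "\<And>n. x n \<in> unit_ball E" "\<And>n. y n = T (x n)" by metis
    then have "range x \<subseteq> (\<lambda>x. x) ` unit_ball E" by auto
    then obtain r where r: "strict_mono (r :: nat \<Rightarrow> nat)" "weakly_p_Cauchy p E (x \<circ> r)"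
      using \<open>WPC p E\<close> unfolding WPC_def weakly_p_precompact_op_def weakly_p_precompact_def by blast
    have "weakly_p_Cauchy p F (y \<circ> r)"
      using weakly_p_Cauchy_image[OF E F T r(2)] by (simp add: x(2) o_def)
    then show ?thesis using r(1) by blast
  qed
  moreover have "T ` unit_ball E \<subseteq> vset F"
    using T unfolding operator_iff[OF E F] by (auto simp: linear_map_def unit_ball_def)
  ultimately show ?thesis
    using T by (simp add: weakly_p_precompact_op_def weakly_p_precompact_def)
qed

text \<open>Passes the property to an isometric copy: precompactness of the image of the ball of
  \<open>E\<close> restricts to the ball of \<open>F\<close>.\<close>

lemma WPC_image:
  assumes E: "normed_space E" and F: "normed_space F" and T: "operator E F T"
    and "WPC p E" and sub: "unit_ball F \<subseteq> T ` unit_ball E"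
  shows "WPC p F"
proof -
  have "weakly_p_precompact p F (T ` unit_ball E)"
    using WPC_imp_weakly_p_precompact_op[OF E F T \<open>WPC p E\<close>]
    by (simp add: weakly_p_precompact_op_def)
  then have "weakly_p_precompact p F ((\<lambda>x. x) ` unit_ball F)"
    using sub unfolding weakly_p_precompact_def image_ident by (meson order_trans)
  moreover have "operator F F (\<lambda>x. x)" by (simp add: operator_def)
  ultimately show ?thesis by (simp add: WPC_def weakly_p_precompact_op_def)
qed

text \<open>Transports the structure along an injection, so that \<open>ell q\<close> has a copy
  with elements in \<open>'u universe\<close>. On the carrier \<open>inv h\<close> is the true
  inverse; values elsewhere are irrelevant to the axioms.\<close>

definition image_space :: "('a \<Rightarrow> 'b) \<Rightarrow> 'a nspace \<Rightarrow> 'b nspace" where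
  "image_space h E =
     \<lparr>vset = h ` vset E,
      vzero = h (vzero E),
      vadd = (\<lambda>x y. h (vadd E (inv h x) (inv h y))),
      vscale = (\<lambda>c x. h (vscale E c (inv h x))),
      vnorm = (\<lambda>x. vnorm E (inv h x))\<rparr>"

context
  fixes h :: "'a \<Rightarrow> 'b" and E :: "'a nspace"
  assumes h: "inj h"
begin

lemma image_space_simps:
  "vset (image_space h E) = h ` vset E"
  "vzero (image_space h E) = h (vzero E)"
  "vadd (image_space h E) (h x) (h y) = h (vadd E x y)"
  "vscale (image_space h E) c (h x) = h (vscale E c x)"
  "vnorm (image_space h E) (h x) = vnorm E x"
  by (simp_all add: image_space_def inv_f_f[OF h])

lemma unit_ball_image_space: "unit_ball (image_space h E) = h ` unit_ball E"
  by (auto simp: unit_ball_def image_space_simps)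

lemma vdist_image_space: "vdist (image_space h E) (h x) (h y) = vdist E x y"
  by (simp add: vdist_def vdiff_def image_space_simps inj_image_mem_iff[OF h])

context
  assumes E: "normed_space E"
begin

interpretation normed_space E by (rule E)

lemma normed_space_image_space: "normed_space (image_space h E)"
  by standard
    (auto simp: image_space_simps inj_eq[OF h] zero_closed add_closed scale_closed add_assoc
      add_zero add_inverse scale_add_right scale_add_left scale_scale scale_one
      norm_nonneg norm_eq_zero norm_scale norm_triangle
      intro: add_commute)

lemma operator_to_image_space: "operator E (image_space h E) h"
  unfolding operator_iff[OF E normed_space_image_space]
  by (auto simp: linear_map_def image_space_simps intro!: exI[of _ 1])

lemma operator_from_image_space: "operator (image_space h E) E (inv h)"
  unfolding operator_iff[OF normed_space_image_space E]
  by (auto simp: linear_map_def image_space_simps inv_f_f[OF h] intro!: exI[of _ 1])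

lemma mcomplete_image_space:
  assumes "Metric_space.mcomplete (vset E) (vdist E)"
  shows "Metric_space.mcomplete (vset (image_space h E)) (vdist (image_space h E))"
proof -
  interpret M: Metric_space "vset E" "vdist E" by (rule metric_space)
  interpret I: Metric_space "vset (image_space h E)" "vdist (image_space h E)"
    by (rule normed_space.metric_space[OF normed_space_image_space])
  show ?thesis
    unfolding I.mcomplete_def
  proof (intro allI impI)
    fix \<sigma> assume \<sigma>: "I.MCauchy \<sigma>"
    then have "range \<sigma> \<subseteq> vset (image_space h E)" by (simp add: I.MCauchy_def)
    then have "range \<sigma> \<subseteq> h ` vset E" by (simp only: image_space_simps(1))
    then have "\<forall>n. \<exists>x. x \<in> vset E \<and> \<sigma> n = h x" by blast
    then obtain \<tau> where \<tau>: "\<And>n. \<tau> n \<in> vset E" "\<And>n. \<sigma> n = h (\<tau> n)" by metis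
    have "M.MCauchy \<tau>"
      using \<sigma> \<tau> by (auto simp: I.MCauchy_def M.MCauchy_def vdist_image_space)
    then obtain x where x: "limitin M.mtopology \<tau> x sequentially"
      using assms by (auto simp: M.mcomplete_def)
    have "limitin I.mtopology \<sigma> (h x) sequentially"
      using x unfolding I.limitin_metric M.limitin_metric
      by (simp add: \<tau>(2) image_space_simps(1) vdist_image_space inj_image_mem_iff[OF h])
    then show "\<exists>y. limitin I.mtopology \<sigma> y sequentially" by blast
  qed
qed

end

end

lemma banach_space_image_space:
  "inj h \<Longrightarrow> banach_space E \<Longrightarrow> banach_space (image_space h E)"
  unfolding banach_space_def banach_space_axioms_def
  using normed_space_image_space mcomplete_image_space by blast


section \<open>Compactness of the adjoint on \<open>L\<close>-sets\<close>

text \<open>Values on \<open>G\<close> are rounded to multiples of e. Boundedness leaves finitely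
  many rounded patterns, and one functional of \<open>A\<close> is kept per pattern; equal patterns
  mean values less than e apart.\<close>

lemma finite_net_on_finite_set:
  fixes A :: "('a \<Rightarrow> real) set"
  assumes "finite G" and B: "\<forall>f\<in>A. \<forall>g\<in>G. \<bar>f g\<bar> \<le> B" and e: "0 < e"
  shows "\<exists>K. finite K \<and> K \<subseteq> A \<and> (\<forall>f\<in>A. \<exists>h\<in>K. \<forall>g\<in>G. \<bar>f g - h g\<bar> \<le> e)"
proof -
  define \<phi> where "\<phi> f = (\<lambda>g\<in>G. \<lfloor>f g / e\<rfloor>)" for f :: "'a \<Rightarrow> real"
  have "\<phi> ` A \<subseteq> PiE G (\<lambda>_. {\<lfloor>- B / e\<rfloor>..\<lfloor>B / e\<rfloor>})"
  proof safe
    fix f g assume "f \<in> A" "g \<in> G"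
    then have "- B \<le> f g" "f g \<le> B" using B by (force simp: abs_le_iff minus_le_iff)+
    then have "- B / e \<le> f g / e" "f g / e \<le> B / e"
      using e divide_right_mono[of _ _ e] by (blast intro: less_imp_le)+
    then show "\<phi> f g \<in> {\<lfloor>- B / e\<rfloor>..\<lfloor>B / e\<rfloor>}"
      using \<open>g \<in> G\<close> by (simp add: \<phi>_def floor_mono)
  qed (simp add: \<phi>_def)
  then have "finite (\<phi> ` A)"
    by (rule finite_subset) (simp add: \<open>finite G\<close> finite_PiE)
  then obtain K where K: "K \<subseteq> A" "finite K" "\<phi> ` A = \<phi> ` K"
    using finite_subset_image[of "\<phi> ` A" \<phi> A] by auto
  have "\<exists>h\<in>K. \<forall>g\<in>G. \<bar>f g - h g\<bar> \<le> e" if "f \<in> A" for f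
  proof -
    obtain h where h: "h \<in> K" "\<phi> f = \<phi> h" using K(3) \<open>f \<in> A\<close> by blast
    have "\<bar>f g - h g\<bar> \<le> e" if "g \<in> G" for g
    proof -
      have "\<lfloor>f g / e\<rfloor> = \<lfloor>h g / e\<rfloor>"
        using fun_cong[OF h(2), of g] that by (simp add: \<phi>_def)
      then have "\<bar>f g / e - h g / e\<bar> \<le> 1" by linarith
      then show ?thesis using e by (simp add: field_simps abs_le_iff flip: diff_divide_distrib)
    qed
    then show ?thesis using h(1) by blast
  qed
  then show ?thesis using K by blast
qed

text \<open>Greedy choice. It is applied when no finite net exists, with \<open>R\<close> saying
  that the later point is far from the earlier one.\<close>

lemma separated_sequence:
  assumes "\<And>G. finite G \<Longrightarrow> G \<subseteq> D \<Longrightarrow> \<exists>z\<in>D. \<forall>g\<in>G. R g z"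
  shows "\<exists>\<sigma> :: nat \<Rightarrow> 'a. range \<sigma> \<subseteq> D \<and> (\<forall>i j. i < j \<longrightarrow> R (\<sigma> i) (\<sigma> j))"
proof -
  have "\<exists>\<sigma>. \<forall>n :: nat. \<sigma> n \<in> D \<and> (\<forall>i<n. R (\<sigma> i) (\<sigma> n))"
  proof (rule dependent_wellorder_choice)
    fix n :: nat and \<sigma> assume "\<And>i. i < n \<Longrightarrow> \<sigma> i \<in> D \<and> (\<forall>k<i. R (\<sigma> k) (\<sigma> i))"
    then have "\<exists>z\<in>D. \<forall>g\<in>\<sigma> ` {..<n}. R g z" by (intro assms) auto
    then show "\<exists>z. z \<in> D \<and> (\<forall>i<n. R (\<sigma> i) z)" by auto
  qed auto
  then show ?thesis by blast
qed

section \<open>The seminorm given by a bounded set of functionals, and the sequential form of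
  \<open>L\<close>-sets\<close>

lemma norm_bounded_dual_bound:
  assumes E: "normed_space E" and A: "norm_bounded (dual E) A"
  shows "\<exists>M. \<forall>f\<in>A. \<forall>x\<in>vset E. \<bar>f x\<bar> \<le> M * vnorm E x"
proof -
  interpret normed_space E by fact
  obtain M where M: "\<And>f. f \<in> A \<Longrightarrow> f \<in> vset (dual E)" "\<And>f. f \<in> A \<Longrightarrow> vnorm (dual E) f \<le> M"
    using A unfolding norm_bounded_def by blast
  have "\<bar>f x\<bar> \<le> M * vnorm E x" if "f \<in> A" "x \<in> vset E" for f x
    using dual_norm_bound[OF M(1)[OF that(1)] that(2)] mult_right_mono[OF M(2)[OF that(1)] norm_nonneg[OF that(2)]]
    by linarith
  then show ?thesis by blast
qed

text \<open>The expression tested in \<open>weakly_p_L_set\<close>, named so that it can be used as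
  a seminorm in which nets are taken.\<close>

definition sup_abs :: "('a \<Rightarrow> real) set \<Rightarrow> 'a \<Rightarrow> real" where
  "sup_abs A x = Sup (insert 0 ((\<lambda>f. \<bar>f x\<bar>) ` A))"

lemma sup_abs_upper:
  assumes E: "normed_space E" and A: "norm_bounded (dual E) A" and f: "f \<in> A" and x: "x \<in> vset E"
  shows "\<bar>f x\<bar> \<le> sup_abs A x"
proof -
  obtain M where "\<And>f. f \<in> A \<Longrightarrow> \<bar>f x\<bar> \<le> M"
    using norm_bounded_dual_bound[OF E A] x by blast
  then have "bdd_above ((\<lambda>f. \<bar>f x\<bar>) ` A)" by (rule bdd_aboveI2)
  then have "bdd_above (insert 0 ((\<lambda>f. \<bar>f x\<bar>) ` A))" by simp
  then show ?thesis unfolding sup_abs_def using f by (intro cSup_upper) auto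
qed

lemma sup_abs_less_obtain:
  assumes "c < sup_abs A x" "0 \<le> c"
  obtains f where "f \<in> A" "c < \<bar>f x\<bar>"
  using assms less_cSupD[of "insert 0 ((\<lambda>f. \<bar>f x\<bar>) ` A)" c] unfolding sup_abs_def by auto

lemma weakly_p_L_set_sup_abs:
  "weakly_p_L_set p E A \<longleftrightarrow> norm_bounded (dual E) A \<and>
    (\<forall>x. weakly_p_summable p E x \<longrightarrow> (\<lambda>n. sup_abs A (x n)) \<longlonglongrightarrow> 0)"
  by (simp add: weakly_p_L_set_def sup_abs_def)

text \<open>A sequence in \<open>A\<close> is dominated by the supremum. Conversely, functionals
  nearly attaining the supremum at each term form a test sequence. For empty \<open>A\<close> no
  test sequence exists, but the supremum is then 0.\<close>

lemma weakly_p_L_set_iff_sequences: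
  fixes E :: "'a nspace"
  assumes E: "normed_space E" and A: "norm_bounded (dual E) A"
  shows "weakly_p_L_set p E A \<longleftrightarrow>
    (\<forall>x f. weakly_p_summable p E x \<longrightarrow> range f \<subseteq> A \<longrightarrow> (\<lambda>n. f n (x n)) \<longlonglongrightarrow> 0)"
proof
  assume L: "weakly_p_L_set p E A"
  show "\<forall>x f. weakly_p_summable p E x \<longrightarrow> range f \<subseteq> A \<longrightarrow> (\<lambda>n. f n (x n)) \<longlonglongrightarrow> 0"
  proof (intro allI impI)
    fix x and f :: "nat \<Rightarrow> 'a \<Rightarrow> real"
    assume x: "weakly_p_summable p E x" and f: "range f \<subseteq> A"
    have lim: "(\<lambda>n. sup_abs A (x n)) \<longlonglongrightarrow> 0"
      using L x by (auto simp: weakly_p_L_set_sup_abs)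
    have "\<bar>f n (x n)\<bar> \<le> sup_abs A (x n)" for n
      using x f by (intro sup_abs_upper[OF E A]) (auto simp: weakly_p_summable_def)
    then show "(\<lambda>n. f n (x n)) \<longlonglongrightarrow> 0"
      by (intro Lim_null_comparison[OF _ lim]) simp
  qed
next
  assume R: "\<forall>x f. weakly_p_summable p E x \<longrightarrow> range f \<subseteq> A \<longrightarrow> (\<lambda>n. f n (x n)) \<longlonglongrightarrow> 0"
  have "(\<lambda>n. sup_abs A (x n)) \<longlonglongrightarrow> 0" if x: "weakly_p_summable p E x" for x
  proof (cases "A = {}")
    case False
    then obtain f0 where f0: "f0 \<in> A" by blast
    have mem: "x n \<in> vset E" for n using x by (auto simp: weakly_p_summable_def)
    have nonneg: "0 \<le> sup_abs A (x n)" for n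
      using sup_abs_upper[OF E A f0 mem[of n]] by linarith
    \<comment> \<open>The supremum need not be attained, hence the factor 2; where it is 0, any
      member of \<open>A\<close> will do.\<close>
    have "\<exists>f\<in>A. sup_abs A (x n) \<le> 2 * \<bar>f (x n)\<bar>" for n
    proof (cases "sup_abs A (x n) = 0")
      case False
      then have "sup_abs A (x n) / 2 < sup_abs A (x n)" "0 \<le> sup_abs A (x n) / 2"
        using nonneg[of n] by auto
      then obtain f where "f \<in> A" "sup_abs A (x n) / 2 < \<bar>f (x n)\<bar>"
        by (rule sup_abs_less_obtain)
      then show ?thesis by (intro bexI[of _ f]) auto
    qed (use f0 in auto)
    then obtain f where f: "\<And>n. f n \<in> A" "\<And>n. sup_abs A (x n) \<le> 2 * \<bar>f n (x n)\<bar>" by metis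
    then have "(\<lambda>n. f n (x n)) \<longlonglongrightarrow> 0" using R x by blast
    then have "(\<lambda>n. 2 * \<bar>f n (x n)\<bar>) \<longlonglongrightarrow> 0"
      using tendsto_mult_right_zero tendsto_rabs_zero by blast
    then show ?thesis
      by (rule Lim_null_comparison[rotated]) (use f nonneg in auto)
  qed (simp add: sup_abs_def)
  then show "weakly_p_L_set p E A" using A by (simp add: weakly_p_L_set_sup_abs)
qed

lemma weakly_p_L_set_imp_relatively_compact:
  assumes Y: "normed_space Y" and F: "normed_space F"
    and L: "weakly_p_L_set p F A" and T: "weakly_p_precompact_op p Y F T"
  shows "relatively_compact (dual Y) (adjoint_op Y T ` A)"
proof -
  interpret F: normed_space F by fact
  let ?D = "T ` unit_ball Y"
  have A: "norm_bounded (dual F) A" using L by (simp add: weakly_p_L_set_def)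
  then have Adual: "A \<subseteq> vset (dual F)" by (simp add: norm_bounded_def)
  have op: "operator Y F T" and pre: "weakly_p_precompact p F ?D"
    using T by (auto simp: weakly_p_precompact_op_def)
  have D: "?D \<subseteq> vset F" using pre by (simp add: weakly_p_precompact_def)
  have net: "\<exists>G. finite G \<and> G \<subseteq> ?D \<and> (\<forall>z\<in>?D. \<exists>g\<in>G. sup_abs A (vdiff F z g) \<le> e)" if "0 < e" for e
  proof (rule ccontr)
    assume *: "\<nexists>G. finite G \<and> G \<subseteq> ?D \<and> (\<forall>z\<in>?D. \<exists>g\<in>G. sup_abs A (vdiff F z g) \<le> e)"
    have "\<exists>z\<in>?D. \<forall>g\<in>G. e < sup_abs A (vdiff F z g)" if "finite G" "G \<subseteq> ?D" for G
    proof (rule ccontr)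
      assume "\<not> (\<exists>z\<in>?D. \<forall>g\<in>G. e < sup_abs A (vdiff F z g))"
      then have "\<forall>z\<in>?D. \<exists>g\<in>G. sup_abs A (vdiff F z g) \<le> e" by (meson not_le)
      then show False using * that by blast
    qed
    then obtain \<sigma> where \<sigma>: "range \<sigma> \<subseteq> ?D"
      and sep: "\<And>i j :: nat. i < j \<Longrightarrow> e < sup_abs A (vdiff F (\<sigma> j) (\<sigma> i))"
      using separated_sequence[of ?D "\<lambda>g z. e < sup_abs A (vdiff F z g)"] by blast
    obtain r where r: "strict_mono (r :: nat \<Rightarrow> nat)" "weakly_p_Cauchy p F (\<sigma> \<circ> r)"
      using pre \<sigma> unfolding weakly_p_precompact_def by blast
    \<comment> \<open>The Cauchy property with the index sequences \<open>Suc\<close> and the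
      identity compares consecutive terms. Their differences tend to 0 in the seminorm, against the
      separation by e.\<close>
    have "weakly_p_summable p F (\<lambda>k. vdiff F ((\<sigma> \<circ> r) (Suc k)) ((\<sigma> \<circ> r) k))"
      using r(2)[unfolded weakly_p_Cauchy_def, THEN conjunct2, rule_format, of Suc "\<lambda>k. k"]
      by (simp add: strict_mono_def)
    then have "(\<lambda>k. sup_abs A (vdiff F (\<sigma> (r (Suc k))) (\<sigma> (r k)))) \<longlonglongrightarrow> 0"
      using L by (simp add: weakly_p_L_set_sup_abs)
    then have "\<forall>\<^sub>F k in sequentially. sup_abs A (vdiff F (\<sigma> (r (Suc k))) (\<sigma> (r k))) < e"
      using \<open>0 < e\<close> by (rule order_tendstoD)
    then obtain k where "sup_abs A (vdiff F (\<sigma> (r (Suc k))) (\<sigma> (r k))) < e"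
      unfolding eventually_sequentially by blast
    then show False using sep[of "r k" "r (Suc k)"] r(1) by (simp add: strict_mono_Suc_iff)
  qed
  show ?thesis
    unfolding relatively_compact_adjoint_iff[OF Y F op Adual]
  proof (intro allI impI)
    fix e :: real assume "0 < e"
    then have e3: "0 < e / 3" by simp
    obtain G where G: "finite G" "G \<subseteq> ?D"
      and near: "\<forall>z\<in>?D. \<exists>g\<in>G. sup_abs A (vdiff F z g) \<le> e / 3"
      using net[OF e3] by blast
    obtain M where M: "\<And>f x. f \<in> A \<Longrightarrow> x \<in> vset F \<Longrightarrow> \<bar>f x\<bar> \<le> M * vnorm F x"
      using norm_bounded_dual_bound[OF F A] by blast
    \<comment> \<open>The sum over \<open>G\<close> is a crude substitute for a maximum that also
      makes sense for empty \<open>G\<close>.\<close>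
    have "\<bar>f g\<bar> \<le> (\<Sum>g\<in>G. \<bar>M * vnorm F g\<bar>)" if "f \<in> A" "g \<in> G" for f g
    proof -
      have "\<bar>f g\<bar> \<le> \<bar>M * vnorm F g\<bar>" using M[of f g] that G(2) D by fastforce
      also have "\<dots> \<le> (\<Sum>g\<in>G. \<bar>M * vnorm F g\<bar>)"
        using member_le_sum[of g G "\<lambda>g. \<bar>M * vnorm F g\<bar>"] G(1) that by simp
      finally show ?thesis .
    qed
    then have bound: "\<forall>f\<in>A. \<forall>g\<in>G. \<bar>f g\<bar> \<le> (\<Sum>g\<in>G. \<bar>M * vnorm F g\<bar>)" by blast
    obtain K where K: "finite K" "K \<subseteq> A"
      and netK: "\<forall>f\<in>A. \<exists>h\<in>K. \<forall>g\<in>G. \<bar>f g - h g\<bar> \<le> e / 3"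
      using finite_net_on_finite_set[OF G(1) bound e3] by blast
    have "\<exists>h\<in>K. \<forall>z\<in>?D. \<bar>f z - h z\<bar> \<le> e" if f: "f \<in> A" for f
    proof -
      obtain h where h: "h \<in> K" "\<forall>g\<in>G. \<bar>f g - h g\<bar> \<le> e / 3" using netK f by blast
      \<comment> \<open>Three thirds: from \<open>z\<close> to a net point \<open>g\<close> under
        \<open>f\<close> and under \<open>h\<close>, each controlled by the seminorm because both
        lie in \<open>A\<close>, and from \<open>f\<close> to \<open>h\<close> at
        \<open>g\<close>.\<close>
      have "\<bar>f z - h z\<bar> \<le> e" if z: "z \<in> ?D" for z
      proof -
        obtain g where g: "g \<in> G" "sup_abs A (vdiff F z g) \<le> e / 3" using near z by blast
        have mem: "z \<in> vset F" "g \<in> vset F" using z g(1) G(2) D by auto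
        have hA: "h \<in> A" using h(1) K(2) by blast
        have "\<bar>f z - f g\<bar> \<le> e / 3" "\<bar>h z - h g\<bar> \<le> e / 3"
          using sup_abs_upper[OF F A f F.diff_closed[OF mem]]
            sup_abs_upper[OF F A hA F.diff_closed[OF mem]] g(2)
            F.dual_diff[OF subsetD[OF Adual f] mem] F.dual_diff[OF subsetD[OF Adual hA] mem]
          by auto
        moreover have "\<bar>f g - h g\<bar> \<le> e / 3" using h(2) g(1) by blast
        ultimately show ?thesis by linarith
      qed
      then show ?thesis using h(1) by blast
    qed
    then show "\<exists>K. finite K \<and> K \<subseteq> A \<and> (\<forall>f\<in>A. \<exists>h\<in>K. \<forall>z\<in>?D. \<bar>f z - h z\<bar> \<le> e)"
      using K by blast
  qed
qed

section \<open>Operators generated by weakly summable sequences\<close>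

lemma ell_tendsto_zero:
  assumes "0 < p" "a \<in> vset (ell p)"
  shows "a \<longlonglongrightarrow> 0"
proof -
  have "(\<lambda>n. \<bar>a n\<bar> powr p) \<longlonglongrightarrow> 0"
    using assms(2) by (intro summable_LIMSEQ_zero) (simp add: ell_simps)
  then have "(\<lambda>n. (\<bar>a n\<bar> powr p) powr (1 / p)) \<longlonglongrightarrow> 0 powr (1 / p)"
    using assms(1) by (intro tendsto_powr2 tendsto_const) auto
  then show ?thesis using assms(1) by (simp add: powr_powr tendsto_rabs_zero_iff)
qed

text \<open>
  By Young's inequality the combinations with coefficients in the unit ball of \<open>\<ell>\<^sub>q\<close> form a
  weakly bounded set.
\<close>

lemma weakly_p_summable_upper_estimate:
  fixes x :: "nat \<Rightarrow> 'a::real_normed_vector"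
  assumes pq: "1 < p" "1 / p + 1 / q = 1"
    and x: "weakly_p_summable p type_space x"
  shows "\<exists>C\<ge>0. \<forall>a F. finite F \<longrightarrow>
    norm (\<Sum>i\<in>F. a i *\<^sub>R x i) \<le> C * (\<Sum>i\<in>F. \<bar>a i\<bar> powr q) powr (1 / q)"
proof -
  have q: "1 < q" by (rule conjugate_exponent[OF pq])
  \<comment> \<open>Arbitrary finite index sets, and not just initial segments, so that the
    resulting estimate also applies to tails of series.\<close>
  define S where "S = {\<Sum>i\<in>F. a i *\<^sub>R x i |a F. finite F \<and> (\<Sum>i\<in>F. \<bar>a i\<bar> powr q) \<le> 1}"
  have weak: "\<exists>M. \<forall>z\<in>S. \<bar>f z\<bar> \<le> M" if f: "bounded_linear f" for f :: "'a \<Rightarrow> real"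
  proof -
    have sum: "summable (\<lambda>i. \<bar>f (x i)\<bar> powr p)"
      using x f by (simp add: weakly_p_summable_def vset_dual_type_space ell_simps)
    have "\<bar>f (\<Sum>i\<in>F. a i *\<^sub>R x i)\<bar> \<le> 1 + (\<Sum>i. \<bar>f (x i)\<bar> powr p)"
      if F: "finite F" "(\<Sum>i\<in>F. \<bar>a i\<bar> powr q) \<le> 1" for a F
    proof -
      have "f (\<Sum>i\<in>F. a i *\<^sub>R x i) = (\<Sum>i\<in>F. a i * f (x i))"
        using bounded_linear.linear[OF f] by (simp add: linear_sum linear_scale)
      then have "\<bar>f (\<Sum>i\<in>F. a i *\<^sub>R x i)\<bar> \<le> (\<Sum>i\<in>F. \<bar>a i\<bar> * \<bar>f (x i)\<bar>)"
        using sum_abs[of "\<lambda>i. a i * f (x i)" F] by (simp add: abs_mult)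
      also have "\<dots> \<le> (\<Sum>i\<in>F. \<bar>a i\<bar> powr q + \<bar>f (x i)\<bar> powr p)"
      proof (rule sum_mono)
        fix i
        have "\<bar>a i\<bar> * \<bar>f (x i)\<bar> \<le> \<bar>a i\<bar> powr q / q + \<bar>f (x i)\<bar> powr p / p"
          using pq q by (intro Youngs_inequality) auto
        \<comment> \<open>The divisors q and p from Young's inequality exceed 1 and are dropped; any
          bound independent of the coefficients is enough.\<close>
        also have "\<dots> \<le> \<bar>a i\<bar> powr q + \<bar>f (x i)\<bar> powr p"
          using pq(1) q by (intro add_mono) (auto simp: divide_le_eq mult_le_cancel_left1)
        finally show "\<bar>a i\<bar> * \<bar>f (x i)\<bar> \<le> \<bar>a i\<bar> powr q + \<bar>f (x i)\<bar> powr p" .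
      qed
      also have "\<dots> \<le> 1 + (\<Sum>i. \<bar>f (x i)\<bar> powr p)"
        using F sum_le_suminf[OF sum F(1)] by (simp add: sum.distrib add_mono)
      finally show ?thesis .
    qed
    then show ?thesis unfolding S_def by blast
  qed
  obtain M where M: "\<And>z. z \<in> S \<Longrightarrow> norm z \<le> M"
    using weakly_bounded_imp_bounded[of S, OF weak] by blast
  have "0 \<in> S" unfolding S_def by (intro CollectI exI[of _ "\<lambda>_. 0"] exI[of _ "{}"]) simp
  then have "0 \<le> M" using M[of 0] by simp
  moreover have "norm (\<Sum>i\<in>F. a i *\<^sub>R x i) \<le> M * (\<Sum>i\<in>F. \<bar>a i\<bar> powr q) powr (1 / q)"
    if F: "finite F" for a F
  proof -
    \<comment> \<open>The \<open>ell q\<close> norm of the coefficients. Dividing by it moves the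
      combination into \<open>S\<close>; if it is 0, all coefficients vanish.\<close>
    define t where "t = (\<Sum>i\<in>F. \<bar>a i\<bar> powr q) powr (1 / q)"
    have nonneg: "0 \<le> (\<Sum>i\<in>F. \<bar>a i\<bar> powr q)" by (simp add: sum_nonneg)
    show ?thesis
    proof (cases "(\<Sum>i\<in>F. \<bar>a i\<bar> powr q) = 0")
      case True
      then have "a i = 0" if "i \<in> F" for i
        using F that by (simp add: sum_nonneg_eq_0_iff)
      then show ?thesis by simp
    next
      case False
      then have t: "0 < t" "t powr q = (\<Sum>i\<in>F. \<bar>a i\<bar> powr q)"
        using q nonneg by (simp_all add: t_def powr_powr)
      have "(\<Sum>i\<in>F. \<bar>a i / t\<bar> powr q) = (\<Sum>i\<in>F. \<bar>a i\<bar> powr q) / t powr q"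
        using t(1) by (simp add: powr_divide sum_divide_distrib)
      also have "\<dots> = 1" using False by (simp add: t(2))
      finally have "(\<Sum>i\<in>F. (a i / t) *\<^sub>R x i) \<in> S"
        unfolding S_def using F
        by (intro CollectI exI[of _ "\<lambda>i. a i / t"] exI[of _ F]) simp
      moreover have "(\<Sum>i\<in>F. (a i / t) *\<^sub>R x i) = (\<Sum>i\<in>F. a i *\<^sub>R x i) /\<^sub>R t"
        by (simp add: scaleR_sum_right divide_inverse mult.commute)
      ultimately have "norm (\<Sum>i\<in>F. a i *\<^sub>R x i) / t \<le> M"
        using M t(1) by (force simp: divide_inverse mult.commute)
      then show ?thesis using t(1) by (simp add: field_simps flip: t_def)
    qed
  qed
  ultimately show ?thesis by blast
qed

text \<open>The upper estimate on segments gives the Cauchy criterion for the series, which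
  converges since the space is complete; on partial sums it bounds the operator. Unit vectors are
  sent to the terms of \<open>x\<close>.\<close>

lemma operator_of_weakly_p_summable:
  fixes x :: "nat \<Rightarrow> 'a::banach"
  assumes pq: "1 < p" "1 / p + 1 / q = 1"
    and x: "weakly_p_summable p type_space x"
  shows "\<exists>T. operator (ell q) type_space T \<and> range x \<subseteq> T ` unit_ball (ell q)"
proof -
  have q: "1 \<le> q" using conjugate_exponent[OF pq] by simp
  obtain C where C: "0 \<le> C" and upper: "\<And>a F. finite F \<Longrightarrow>
      norm (\<Sum>i\<in>F. a i *\<^sub>R x i) \<le> C * (\<Sum>i\<in>F. \<bar>a i\<bar> powr q) powr (1 / q)"
    using weakly_p_summable_upper_estimate[OF pq x] by blast
  have sum: "summable (\<lambda>i. a i *\<^sub>R x i)" if a: "a \<in> vset (ell q)" for a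
    unfolding summable_Cauchy
  proof (intro allI impI)
    fix e :: real assume e: "0 < e"
    have "summable (\<lambda>i. \<bar>a i\<bar> powr q)" using a by (simp add: ell_simps)
    \<comment> \<open>\<open>C\<close> may be 0, so \<open>C + 1\<close> serves as divisor.\<close>
    moreover have "0 < (e / (C + 1)) powr q" using e C by simp
    ultimately obtain N where N: "\<forall>m\<ge>N. \<forall>n. norm (\<Sum>i=m..<n. \<bar>a i\<bar> powr q) < (e / (C + 1)) powr q"
      unfolding summable_Cauchy by blast
    have "norm (\<Sum>i=m..<n. a i *\<^sub>R x i) < e" if m: "N \<le> m" for m n
    proof -
      let ?s = "(\<Sum>i=m..<n. \<bar>a i\<bar> powr q)"
      have s0: "0 \<le> ?s" by (simp add: sum_nonneg)
      moreover have "?s < (e / (C + 1)) powr q"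
        using N[rule_format, OF m, of n] unfolding real_norm_def abs_of_nonneg[OF s0] .
      ultimately have "?s powr (1 / q) < ((e / (C + 1)) powr q) powr (1 / q)"
        using q by (intro powr_less_mono2) auto
      then have s: "?s powr (1 / q) < e / (C + 1)" using q e C by (simp add: powr_powr)
      have "norm (\<Sum>i=m..<n. a i *\<^sub>R x i) \<le> C * ?s powr (1 / q)" by (intro upper) simp
      also have "\<dots> \<le> (C + 1) * ?s powr (1 / q)" by (intro mult_right_mono) auto
      also have "\<dots> < (C + 1) * (e / (C + 1))" using s C by (intro mult_strict_left_mono) auto
      also have "\<dots> = e" using C by simp
      finally show ?thesis .
    qed
    then show "\<exists>N. \<forall>m\<ge>N. \<forall>n. norm (\<Sum>i=m..<n. a i *\<^sub>R x i) < e" by blast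
  qed
  define T where "T a = (\<Sum>i. a i *\<^sub>R x i)" for a
  have bound: "norm (T a) \<le> C * vnorm (ell q) a" if a: "a \<in> vset (ell q)" for a
  proof (rule Lim_bounded[where M = 0])
    show "(\<lambda>n. norm (\<Sum>i<n. a i *\<^sub>R x i)) \<longlonglongrightarrow> norm (T a)"
      unfolding T_def by (intro tendsto_norm summable_LIMSEQ sum a)
    show "\<forall>n\<ge>0. norm (\<Sum>i<n. a i *\<^sub>R x i) \<le> C * vnorm (ell q) a"
    proof (intro allI impI)
      fix n
      have "(\<Sum>i<n. \<bar>a i\<bar> powr q) \<le> (\<Sum>i. \<bar>a i\<bar> powr q)"
        using a by (intro sum_le_suminf) (auto simp: ell_simps)
      then have "(\<Sum>i<n. \<bar>a i\<bar> powr q) powr (1 / q) \<le> vnorm (ell q) a"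
        unfolding ell_simps using q by (intro powr_mono2) (auto simp: sum_nonneg)
      then have "C * (\<Sum>i<n. \<bar>a i\<bar> powr q) powr (1 / q) \<le> C * vnorm (ell q) a"
        using C by (rule mult_left_mono)
      then show "norm (\<Sum>i<n. a i *\<^sub>R x i) \<le> C * vnorm (ell q) a"
        using upper[of "{..<n}" a] by simp
    qed
  qed
  have add: "T (\<lambda>n. a n + b n) = T a + T b" if "a \<in> vset (ell q)" "b \<in> vset (ell q)" for a b
    unfolding T_def using suminf_add[OF sum[OF that(1)] sum[OF that(2)]] by (simp add: scaleR_left_distrib)
  have scale: "T (\<lambda>n. c * a n) = c *\<^sub>R T a" if "a \<in> vset (ell q)" for c a
    unfolding T_def using suminf_scaleR_right[OF sum[OF that], of c] by simp
  have "operator (ell q) type_space T"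
    unfolding operator_iff[OF normed_space_ell[OF q] normed_space_type_space]
    using bound add scale by (auto simp: linear_map_def ell_simps(3,4))
  moreover have "x n \<in> T ` unit_ball (ell q)" for n
  proof
    \<comment> \<open>The n-th unit vector, for which the series has the single term
      \<open>x n\<close>.\<close>
    let ?e = "\<lambda>i. if i = n then 1 else (0 :: real)"
    have "(\<Sum>j<m. \<bar>?e j\<bar> powr q) \<le> 1 powr q" for m
      by (simp add: if_distrib if_distribR sum.delta cong: if_cong)
    then show "?e \<in> unit_ball (ell q)"
      using ell_norm_le_iff[OF q zero_le_one, of ?e] by (simp add: unit_ball_def)
    show "x n = T ?e"
      unfolding T_def by (subst suminf_finite[of "{n}"]) auto
  qed
  ultimately show ?thesis by blast
qed

lemma relatively_compact_imp_tendsto_zero: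
  fixes x :: "nat \<Rightarrow> 'a::banach"
  assumes pq: "1 < p" "1 / p + 1 / q = 1"
    and A: "A \<subseteq> vset (dual type_space)"
    and compact: "\<And>T. operator (ell q) type_space T \<Longrightarrow>
      relatively_compact (dual (ell q)) (adjoint_op (ell q) T ` A)"
    and x: "weakly_p_summable p type_space x" and f: "range f \<subseteq> A"
  shows "(\<lambda>n. f n (x n)) \<longlonglongrightarrow> 0"
proof (rule tendstoI)
  fix e :: real assume "0 < e"
  then have e2: "0 < e / 2" by simp
  have q: "1 \<le> q" using conjugate_exponent[OF pq] by simp
  obtain T where T: "operator (ell q) type_space T" and xT: "range x \<subseteq> T ` unit_ball (ell q)"
    using operator_of_weakly_p_summable[OF pq x] by blast
  obtain K where K: "finite K" "K \<subseteq> A"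
    and net: "\<forall>g\<in>A. \<exists>h\<in>K. \<forall>z\<in>T ` unit_ball (ell q). \<bar>g z - h z\<bar> \<le> e / 2"
    using compact[OF T,
        unfolded relatively_compact_adjoint_iff[OF normed_space_ell[OF q] normed_space_type_space T A],
        rule_format, OF e2]
    by (elim exE conjE)
  have "\<forall>\<^sub>F n in sequentially. \<bar>h (x n)\<bar> < e / 2" if "h \<in> K" for h
  proof -
    have "(\<lambda>n. h (x n)) \<in> vset (ell p)"
      using x that K(2) A by (auto simp: weakly_p_summable_def)
    then have "(\<lambda>n. \<bar>h (x n)\<bar>) \<longlonglongrightarrow> 0"
      using pq(1) by (intro tendsto_rabs_zero ell_tendsto_zero[of p]) auto
    then show ?thesis using e2 by (rule order_tendstoD)
  qed
  \<comment> \<open>The net element close to \<open>f n\<close> varies with n, so smallness is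
    needed for all of \<open>K\<close> at once; this is where finiteness enters.\<close>
  then have "\<forall>\<^sub>F n in sequentially. \<forall>h\<in>K. \<bar>h (x n)\<bar> < e / 2"
    using K(1) by (simp add: eventually_ball_finite)
  then show "\<forall>\<^sub>F n in sequentially. dist (f n (x n)) 0 < e"
  proof (rule eventually_mono)
    fix n assume small: "\<forall>h\<in>K. \<bar>h (x n)\<bar> < e / 2"
    obtain h where h: "h \<in> K" "\<forall>z\<in>T ` unit_ball (ell q). \<bar>f n z - h z\<bar> \<le> e / 2"
      using net f by blast
    then have "\<bar>f n (x n) - h (x n)\<bar> \<le> e / 2" using xT by blast
    moreover have "\<bar>h (x n)\<bar> < e / 2" using small h(1) by blast
    ultimately have "\<bar>f n (x n)\<bar> < e" by linarith
    then show "dist (f n (x n)) 0 < e" by simp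
  qed
qed

text \<open>Composing \<open>T\<close> with the inverse of the isometry leaves the image of the unit
  ball unchanged, and compactness depends on that image alone.\<close>

lemma relatively_compact_ell_copy:
  fixes h :: "(nat \<Rightarrow> real) \<Rightarrow> 'b"
  assumes q: "1 \<le> q" and h: "inj h" and F: "normed_space F"
    and T: "operator (ell q) F T" and A: "A \<subseteq> vset (dual F)"
    and compact: "\<And>T. operator (image_space h (ell q)) F T \<Longrightarrow>
      relatively_compact (dual (image_space h (ell q))) (adjoint_op (image_space h (ell q)) T ` A)"
  shows "relatively_compact (dual (ell q)) (adjoint_op (ell q) T ` A)"
proof -
  note E = normed_space_ell[OF q]
  note I = normed_space_image_space[OF h E]
  let ?T = "\<lambda>y. T (inv h y)"
  have op: "operator (image_space h (ell q)) F ?T"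
    by (rule operator_compose[OF operator_from_image_space[OF h E] T I E])
  have "?T ` unit_ball (image_space h (ell q)) = T ` unit_ball (ell q)"
    by (simp add: unit_ball_image_space[OF h] image_image inv_f_f[OF h])
  then show ?thesis
    using compact[OF op]
    unfolding relatively_compact_adjoint_iff[OF I F op A] relatively_compact_adjoint_iff[OF E F T A]
    by simp
qed

theorem theorem19:
  fixes p q :: real and A :: "('x::banach \<Rightarrow> real) set"
  defines "X \<equiv> (type_space :: 'x nspace)"
  assumes "1 < p" and "1 / p + 1 / q = 1"
    and "norm_bounded (dual X) A"
  shows "all_equivalent
    [weakly_p_L_set p X A,
     \<forall>(Y :: 'u universe nspace) T.
       banach_space Y \<longrightarrow> weakly_p_precompact_op p Y X T \<longrightarrow>
       relatively_compact (dual Y) (adjoint_op Y T ` A),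
     \<forall>(Y :: 'u universe nspace) T.
       banach_space Y \<longrightarrow> WPC p Y \<longrightarrow> operator Y X T \<longrightarrow>
       relatively_compact (dual Y) (adjoint_op Y T ` A),
     \<forall>T. operator (ell q) X T \<longrightarrow>
       relatively_compact (dual (ell q)) (adjoint_op (ell q) T ` A),
     \<forall>x f. weakly_p_summable p X x \<longrightarrow> range f \<subseteq> A \<longrightarrow>
       (\<lambda>n. f n (x n)) \<longlonglongrightarrow> (0 :: real)]"
    (is "all_equivalent [?i, ?ii, ?iii, ?iv, ?v]")
proof -
  note pq = assms(2,3)
  have q: "1 \<le> q" using conjugate_exponent[OF pq] by simp
  have X: "normed_space X" unfolding X_def by (rule normed_space_type_space)
  have A: "A \<subseteq> vset (dual X)" using assms(4) by (simp add: norm_bounded_def)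
  have i_v: "?i \<longleftrightarrow> ?v" by (rule weakly_p_L_set_iff_sequences[OF X assms(4)])
  have i_ii: ?ii if ?i
    using weakly_p_L_set_imp_relatively_compact[OF _ X that] by (auto simp: banach_space_def)
  have ii_iii: ?iii if ?ii
  proof (intro allI impI)
    fix Y :: "'u universe nspace" and T
    assume Y: "banach_space Y" and "WPC p Y" "operator Y X T"
    then have "weakly_p_precompact_op p Y X T"
      by (intro WPC_imp_weakly_p_precompact_op X) (simp_all add: banach_space_def)
    then show "relatively_compact (dual Y) (adjoint_op Y T ` A)"
      using that Y by blast
  qed
  have iii_iv: ?iv if iii: ?iii
  proof (intro allI impI)
    fix T assume T: "operator (ell q) X T"
    \<comment> \<open>The second summand of \<open>'u universe\<close> holds the copy of
      \<open>ell q\<close>, so (iii) applies to it whatever \<open>'u\<close> is.\<close>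
    let ?h = "Inr :: (nat \<Rightarrow> real) \<Rightarrow> 'u universe"
    have h: "inj ?h" by simp
    note E = normed_space_ell[OF q]
    have "WPC p (image_space ?h (ell q))"
      by (rule WPC_image[OF E normed_space_image_space[OF h E] operator_to_image_space[OF h E]
            WPC_ell[OF pq]]) (simp add: unit_ball_image_space[OF h])
    then show "relatively_compact (dual (ell q)) (adjoint_op (ell q) T ` A)"
      using iii banach_space_image_space[OF h banach_space_ell[OF q]]
      by (intro relatively_compact_ell_copy[OF q h X T A]) blast
  qed
  have iv_v: ?v if ?iv
  proof (intro allI impI)
    fix x and f :: "nat \<Rightarrow> 'x \<Rightarrow> real"
    assume "weakly_p_summable p X x" "range f \<subseteq> A"
    then show "(\<lambda>n. f n (x n)) \<longlonglongrightarrow> 0"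
      using that relatively_compact_imp_tendsto_zero[OF pq A[unfolded X_def]] by (simp add: X_def)
  qed
  \<comment> \<open>The implications form the cycle (i), (ii), (iii), (iv), (v), closed by the
    equivalence of (v) and (i).\<close>
  have "?i = ?v" "?ii = ?v" "?iii = ?v" "?iv = ?v"
    using i_v i_ii ii_iii iii_iv iv_v by argo+
  then show ?thesis by (simp add: all_equivalent_def)
qed

end
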